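(* Let $a\in\mathbb{N}$. Assume that a triangular array $[T_{n,k}]_{n,k\ge 0}$ (a generalized Lah triangle) satisfies the recurrence relation $$T_{n,k}=c\,T_{n-1,k-1}+[ab(n-1)+bk+abd+c\lambda]\,T_{n-1,k}+b\lambda(k+1)\,T_{n-1,k+1}$$ for $n,k\ge 1$, where $T_{0,0}=1$. Let $T_n(q)=\sum_{k\ge 0}T_{n,k}q^k$. Then: (i) an explicit formula of $T_{n,k}$ is given by $$T_{n,k}=\frac{a^n}{k!}\sum_{j\ge 0}\sum_{i=0}^{k+j}\frac{(-1)^{n+k+j-i}b^{n-k-j}c^{k+j}\lambda^j}{j!}\binom{k+j}{i}\Big(-\frac{i+ad}{a}\Big)_n$$ for $n,k\ge 1$; (ii) for $d\in\mathbb{N}$ and $c\in\mathbb{R}^{+}$, the lower-triangular matrix $[T_{n,k}]_{n,k\ge 0}$ is $(b,\lambda)$-TP; (iii) for $c=b$, the lower-triangular matrix $[T_{n,k}]_{n,k\ge 0}$ is $(b,d,\lambda)$-TP; (iv) for $c=b$, the sequence $(T_n(q))_{n\ge 0}$ is $(b,d,\lambda,q)$-SM and $3$-$(b,d,\lambda,q)$-log-convex; in particular, $(T_{n,0})_{n\ge 0}$ is $(b,d,\lambda)$-SM and $3$-$(b,d,\lambda)$-log-convex; (v) for $b>0$, the sequence $(f_n)_{n\ge 1}$ is SM, where $\sum_{n\ge 1}f_n\frac{t^n}{n!}=\frac{(1-abt)^{-1/a}-1}{b}$; (vi) for $c=b$ and $\{b,d,\lambda\}\subseteq\mathbb{R}^{\ge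 0}$, the convolution $z_n=\sum_{k\ge 0}T_{n,k}x_ky_{n-k}$ preserves the Stieltjes moment property of sequences; (vii) if $a+1=m$ and $d=0$, then $\sum_{n\ge 0}T_n(q)t^n$ equals the $m$-branched Stieltjes-type continued fraction with coefficients $$(\alpha_i)_{i\ge m}=(c(q+\lambda),\underbrace{b,\ldots,b}_{m},c(q+\lambda),\underbrace{2b,\ldots,2b}_{m},c(q+\lambda),\underbrace{3b,\ldots,3b}_{m},\ldots);$$ in particular, for $q=0$, $\sum_{n\ge 0}T_{n,0}t^n$ equals the $m$-branched Stieltjes-type continued fraction with coefficients $$(\alpha_i)_{i\ge m}=(c\lambda,\underbrace{b,\ldots,b}_{m},c\lambda,\underbrace{2b,\ldots,2b}_{m},c\lambda,\underbrace{3b,\ldots,3b}_{m},\ldots);$$ (viii) the row sequence $(T_{n,k})_{k=0}^n$ is a PF sequence for $\{b,c,d,\lambda\}\subseteq\mathbb{R}^{\ge 0}$.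
   Context: $\mathbb{N}$ is the set of nonnegative integers, $\mathbb{R}^{+}$ the set of positive reals and $\mathbb{R}^{\ge 0}$ the set of nonnegative reals. $(x)_n=x(x-1)\cdots(x-n+1)$ is the falling factorial. Parameters not specialized to real values are indeterminates. A real matrix is TP (totally positive) if all its minors are nonnegative. For a set $\mathbf{x}$ of indeterminates, a matrix with entries in $\mathbb{R}[\mathbf{x}]$ is $\mathbf{x}$-TP if all its minors are polynomials with nonnegative coefficients in $\mathbf{x}$. A sequence $(\alpha_n)_{n\ge 0}$ in $\mathbb{R}[\mathbf{x}]$ is $\mathbf{x}$-SM if its Hankel matrix $[\alpha_{i+j}]_{i,j\ge 0}$ is $\mathbf{x}$-TP. Let $\mathcal{L}[\alpha_i]=\alpha_{i-1}\alpha_{i+1}-\alpha_i^2$ and $\mathcal{L}^m=\mathcal{L}(\mathcal{L}^{m-1})$; the sequence is $3$-$\mathbf{x}$-log-convex if, for every $m\le 3$, all $\mathcal{L}^m[\alpha_i]$ are polynomials with nonnegative coefficients in $\mathbf{x}$. A real sequence $(a_k)_{k\ge 0}$ is SM (a Stieltjes moment sequence) if $a_k=\int_0^{+\infty}x^k\,d\mu(x)$ for a nonnegative measure $\mu$ on $[0,+\infty)$; $(f_n)_{n\ge 1}$ being SM means that $(f_{n+1})_{n\ge 0}$ is SM. A convolution preserves the Stieltjes moment property if $(z_n)_{n\ge 0}$ is a Stieltjes moment sequence whenever both $(x_n)_{n\ge 0}$ and $(y_n)_{n\ge 0}$ are. A finite sequence is a PF (Pólya frequency) sequence if, after extension by zeros,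 its infinite Toeplitz matrix $[a_{i-j}]_{i,j\ge 0}$ is TP. The $m$-branched Stieltjes-type continued fraction with coefficients $(\alpha_i)_{i\ge m}$ is the formal power series in $t$ $$\cfrac{1}{1-\alpha_mt\prod\limits_{i_1=1}^m\cfrac{1}{1-\alpha_{m+i_1}t\prod\limits_{i_2=1}^m\cfrac{1}{1-\alpha_{m+i_1+i_2}t\prod\limits_{i_3=1}^m\cfrac{1}{1-\cdots}}}}.$$
   Formalization: The recurrence is also assumed for k=0 (with T_{n-1,-1}=0), since column 0 would otherwise be arbitrary and the claims fail; for a=0, where (i) and (v) divide by a, the limiting expressions (-i)^n and exp(bt) are used; (i) takes b nonzero. *)

theory Defs
  imports
    "HOL-Analysis.Lebesgue_Measure"
    "HOL-Analysis.Bochner_Integration"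
    "HOL-Computational_Algebra.Formal_Power_Series"
    "HOL-Library.Poly_Mapping"
    "HOL-Library.Groups_Big_Fun"
    "Jordan_Normal_Form.Determinant"
begin

section \<open>Polynomials with real coefficients\<close>

text \<open>
  Multivariate polynomials are finitely supported maps from monomials to coefficients, and a
  monomial is a finitely supported map from indeterminates to exponents.
\<close>

datatype indet = Ind_b | Ind_d | Ind_lam | Ind_q

type_synonym rpoly = "(indet \<Rightarrow>\<^sub>0 nat) \<Rightarrow>\<^sub>0 real"

definition Var :: "indet \<Rightarrow> rpoly"
  where "Var v = Poly_Mapping.single (Poly_Mapping.single v 1) 1"

definition Const :: "real \<Rightarrow> rpoly"
  where "Const r = Poly_Mapping.single 0 r"

definition nonneg_poly :: "indet set \<Rightarrow> rpoly \<Rightarrow> bool"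
  where "nonneg_poly X p \<longleftrightarrow>
    (\<forall>u\<in>Poly_Mapping.keys p. Poly_Mapping.keys u \<subseteq> X) \<and> (\<forall>u. Poly_Mapping.lookup p u \<ge> 0)"

section \<open>Total positivity\<close>

text \<open>
  The minors of the infinite matrix \<open>A\<close> are indexed by increasing sequences \<open>r\<close> of rows and
  \<open>s\<close> of columns, of which only the values below \<open>k\<close> matter.
\<close>

definition minor :: "(nat \<Rightarrow> nat \<Rightarrow> 'a::comm_ring_1) \<Rightarrow> nat \<Rightarrow> (nat \<Rightarrow> nat) \<Rightarrow> (nat \<Rightarrow> nat) \<Rightarrow> 'a"
  where "minor A k r s = Determinant.det (Matrix.mat k k (\<lambda>(i, j). A (r i) (s j)))"

definition all_minors :: "('a::comm_ring_1 \<Rightarrow> bool) \<Rightarrow> (nat \<Rightarrow> nat \<Rightarrow> 'a) \<Rightarrow> bool"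
  where "all_minors P A \<longleftrightarrow>
    (\<forall>k r s. strict_mono_on {..<k} r \<and> strict_mono_on {..<k} s \<longrightarrow> P (minor A k r s))"

definition TP :: "(nat \<Rightarrow> nat \<Rightarrow> real) \<Rightarrow> bool"
  where "TP A \<longleftrightarrow> all_minors (\<lambda>x. x \<ge> 0) A"

definition poly_TP :: "indet set \<Rightarrow> (nat \<Rightarrow> nat \<Rightarrow> rpoly) \<Rightarrow> bool"
  where "poly_TP X A \<longleftrightarrow> all_minors (nonneg_poly X) A"

definition poly_SM :: "indet set \<Rightarrow> (nat \<Rightarrow> rpoly) \<Rightarrow> bool"
  where "poly_SM X \<alpha> \<longleftrightarrow> poly_TP X (\<lambda>i j. \<alpha> (i + j))"

definition PF_seq :: "nat \<Rightarrow> (nat \<Rightarrow> real) \<Rightarrow> bool"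
  where "PF_seq n s \<longleftrightarrow> TP (\<lambda>i j. if j \<le> i \<and> i - j \<le> n then s (i - j) else 0)"

section \<open>Log-convexity\<close>

definition log_op :: "(nat \<Rightarrow> 'a::comm_ring_1) \<Rightarrow> nat \<Rightarrow> 'a"
  where "log_op \<alpha> i = \<alpha> (i - 1) * \<alpha> (i + 1) - (\<alpha> i)\<^sup>2"

text \<open>
  For a sequence starting at index 0, the \<open>m\<close>-th iterate only makes sense from index \<open>m\<close> on;
  for those indices the subtraction in \<open>log_op\<close> is never truncated.
\<close>

definition poly_log_convex :: "indet set \<Rightarrow> nat \<Rightarrow> (nat \<Rightarrow> rpoly) \<Rightarrow> bool"
  where "poly_log_convex X r \<alpha> \<longleftrightarrow> (\<forall>m\<le>r. \<forall>i\<ge>m. nonneg_poly X ((log_op ^^ m) \<alpha> i))"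

section \<open>Stieltjes moment sequences\<close>

text \<open>Integrability has to be required, since the integral of a non-integrable function is 0.\<close>

definition stieltjes_moment :: "(nat \<Rightarrow> real) \<Rightarrow> bool"
  where "stieltjes_moment s \<longleftrightarrow>
    (\<exists>\<mu>. sets \<mu> = sets (restrict_space borel {0::real..}) \<and>
      (\<forall>k. integrable \<mu> (\<lambda>x. x ^ k) \<and> s k = (\<integral>x. x ^ k \<partial>\<mu>)))"

section \<open>Branched continued fractions\<close>

text \<open>
  The branch starting with the coefficient \<open>\<alpha> k\<close>, cut off after \<open>N\<close> levels of nesting.
\<close>

primrec branched_trunc :: "nat \<Rightarrow> (nat \<Rightarrow> 'a::field) \<Rightarrow> nat \<Rightarrow> nat \<Rightarrow> 'a fps"
  where
    "branched_trunc m \<alpha> 0 k = 1"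
  | "branched_trunc m \<alpha> (Suc N) k =
      1 / (1 - fps_const (\<alpha> k) * fps_X * (\<Prod>i=1..m. branched_trunc m \<alpha> N (k + i)))"

text \<open>
  The infinite fraction is the limit of its truncations for the usual metric on formal power
  series; only the values \<open>\<alpha> i\<close> with \<open>i \<ge> m\<close> are used.
\<close>

definition is_branched_S_fraction :: "nat \<Rightarrow> (nat \<Rightarrow> 'a::field) \<Rightarrow> 'a fps \<Rightarrow> bool"
  where "is_branched_S_fraction m \<alpha> F \<longleftrightarrow> (\<lambda>N. branched_trunc m \<alpha> N m) \<longlonglongrightarrow> F"

text \<open>
  From index \<open>m\<close> on, the sequence is \<open>x\<close>, \<open>m\<close> times \<open>y\<close>, \<open>x\<close>, \<open>m\<close> times \<open>2 y\<close>, and so on.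
\<close>

definition lah_branch_coeff :: "nat \<Rightarrow> 'a::field \<Rightarrow> 'a \<Rightarrow> nat \<Rightarrow> 'a"
  where "lah_branch_coeff m x y i =
    (if (i - m) mod (m + 1) = 0 then x else of_nat ((i - m) div (m + 1) + 1) * y)"

section \<open>Generalized Lah triangles\<close>

text \<open>
  The last clause is the recurrence for \<open>k = 0\<close>, where the entry with column index \<open>-1\<close> is 0.
\<close>

definition generalized_lah ::
    "nat \<Rightarrow> 'a::comm_ring_1 \<Rightarrow> 'a \<Rightarrow> 'a \<Rightarrow> 'a \<Rightarrow> (nat \<Rightarrow> nat \<Rightarrow> 'a) \<Rightarrow> bool"
  where "generalized_lah a b c d lam T \<longleftrightarrow>
    T 0 0 = 1 \<and>
    (\<forall>n k. k > n \<longrightarrow> T n k = 0) \<and>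
    (\<forall>n\<ge>1. \<forall>k\<ge>1. T n k =
      c * T (n - 1) (k - 1)
      + (of_nat a * b * of_nat (n - 1) + b * of_nat k + of_nat a * b * d + c * lam) * T (n - 1) k
      + b * lam * of_nat (k + 1) * T (n - 1) (k + 1)) \<and>
    (\<forall>n\<ge>1. T n 0 =
      (of_nat a * b * of_nat (n - 1) + of_nat a * b * d + c * lam) * T (n - 1) 0
      + b * lam * T (n - 1) 1)"

definition row_poly :: "(nat \<Rightarrow> nat \<Rightarrow> 'a::comm_ring_1) \<Rightarrow> nat \<Rightarrow> 'a \<Rightarrow> 'a"
  where "row_poly T n q = (\<Sum>k\<le>n. T n k * q ^ k)"

definition preserves_stieltjes :: "(nat \<Rightarrow> nat \<Rightarrow> real) \<Rightarrow> bool"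
  where "preserves_stieltjes T \<longleftrightarrow>
    (\<forall>x y. stieltjes_moment x \<and> stieltjes_moment y \<longrightarrow>
      stieltjes_moment (\<lambda>n. \<Sum>k\<le>n. T n k * x k * y (n - k)))"

definition ffact :: "'a::comm_ring_1 \<Rightarrow> nat \<Rightarrow> 'a"
  where "ffact x n = (\<Prod>i<n. x - of_nat i)"

text \<open>
  The summand of index \<open>j\<close> in the explicit formula for the entries; \<open>G i\<close> stands for the
  falling factorial in it. The exponent of \<open>b\<close> may be negative.
\<close>

definition lah_summand ::
    "(nat \<Rightarrow> 'a::field_char_0) \<Rightarrow> 'a \<Rightarrow> 'a \<Rightarrow> 'a \<Rightarrow> nat \<Rightarrow> nat \<Rightarrow> nat \<Rightarrow> 'a"
  where "lah_summand G b c lam n k j =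
    (\<Sum>i\<le>k + j. (-1) ^ (n + k + j - i) * (b powi (int n - int k - int j)) * c ^ (k + j) * lam ^ j
      / fact j * of_nat ((k + j) choose i) * G i)"

text \<open>
  The formal power series \<open>(1 - abt)\<close> to the power \<open>-1/a\<close>. For \<open>a = 0\<close>, where the
  exponent is undefined, this is its limit for \<open>a\<close> tending to 0.
\<close>

definition lah_root_fps :: "nat \<Rightarrow> real \<Rightarrow> real fps"
  where "lah_root_fps a b =
    (if a = 0 then fps_exp b
     else fps_compose (fps_binomial (- 1 / of_nat a)) (- (fps_const (of_nat a * b) * fps_X)))"

end

theory Submission
  imports Defs "HOL-Analysis.Gamma_Function" "HOL-Computational_Algebra.Fundamental_Theorem_Algebra"
begin

text \<open>
  Dividing column \<open>k\<close> by \<open>c ^ k\<close> reduces the recurrence to the case \<open>c = 1\<close>, with \<open>lam\<close> replaced by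
  \<open>x = c * lam\<close>; the normalised triangle is \<open>lah_tri\<close>. Read its row \<open>n\<close> as a polynomial \<open>R n\<close> in an
  indeterminate \<open>u\<close>, and let \<open>D\<close> be the derivative with respect to \<open>u\<close>. The recurrence says
  \<open>R (n + 1) = (A + a b n) (R n)\<close> with \<open>A = (u + x) (1 + b D) + a b d\<close>. The summand \<open>a b n\<close> changes
  from row to row, but \<open>E = 1 + b D\<close> satisfies \<open>E A = (A + b) E\<close>, and therefore also
  \<open>R (n + 1) = A (E ^ a (R n))\<close> (\<open>lah_tri_production\<close>): one fixed operator, a product of sparse factors,
  generates the whole triangle. Moreover the substitution of \<open>u + q\<close> for \<open>u\<close> only changes \<open>x\<close> to
  \<open>x + q\<close>, so that \<open>T_n(q)\<close> is the entry of the first column for \<open>x = c (q + lam)\<close>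
  (\<open>row_poly_generalized_lah\<close>). Statements on the sequence of the \<open>T_n(q)\<close> are thus statements about one column.

  Total positivity. Each factor of the production operator replaces the columns of a matrix by
  combinations of old columns whose supports move weakly to the right. By multilinearity a minor of
  the new matrix is a combination of determinants in weakly increasing old columns, and those with
  a repeated column vanish. Hence total positivity survives, with nonnegativity replaced by
  membership in any set of ring elements that contains 0 and 1 and is closed under sums and
  products (\<open>all_minors_staircase\<close>). Generating the rows one after the other gives the total
  positivity of the triangle, and generating them to the right of the columns already found gives
  that of the Hankel matrix of the first column. The iterated log-convexity operators are
  expressed through Hankel minors by Dodgson condensation (\<open>log_op_twice\<close>, \<open>log_op_thrice\<close>).

  Continued fraction. For \<open>d = 0\<close> the production operator is \<open>(u + x) E ^ (a + 1)\<close>. The generating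
  functions of the entries of \<open>E ^ i (R (n + k))\<close> in column \<open>k\<close>, taken in the order in which the
  factors act, satisfy a recurrence of Euler-Gauss type, whose consecutive quotients are the
  branches of the fraction (\<open>branched_S_fraction_Euler_Gauss\<close>).

  Explicit formula and moments. For \<open>x = 0\<close> the entries of row \<open>n\<close> are, up to powers of
  \<open>b\<close>, the coefficients with respect to falling factorials of the polynomial \<open>\<Prod>l<n. b N + a b (d + l)\<close> in \<open>N\<close>. Finite differences give the explicit formula.
  Averaging over a Poisson variable \<open>N\<close> gives a formula of Dobinski type for the first column
  (\<open>lah_tri_Dobinski\<close>). For each fixed \<open>N\<close> the product is, as a sequence in \<open>n\<close>, the moment sequence
  of a scaled gamma variable or of a constant, so that the convolution is a mixture of products of moment
  sequences. The sequence \<open>f\<close> is such a product, too (\<open>fps_nth_lah_root\<close>).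

  Rows. In terms of polynomials a step is \<open>p \<mapsto> (u + y) p + b u p'\<close>. If \<open>p\<close> has only real roots \<open>\<le> 0\<close>,
  then \<open>z p'(z) / p(z)\<close> has a nonnegative imaginary part in the upper half-plane, so the new
  polynomial has no root there (\<open>split_Euler_step\<close>). A product of factors \<open>r + s u\<close> with
  \<open>r, s \<ge> 0\<close> has a totally positive Toeplitz matrix, because multiplication by such a factor is
  again a combination of neighbouring columns.
\<close>

section \<open>Total positivity over a cone\<close>

lemma minor_cong:
  "(\<And>i j. i < k \<Longrightarrow> j < k \<Longrightarrow> A (r i) (s j) = B (r' i) (s' j)) \<Longrightarrow> minor A k r s = minor B k r' s'"
  unfolding minor_def by (intro arg_cong[where f = Determinant.det] cong_mat) auto

lemma minor_eq_columns:
  assumes "i < j" "j < k" "s i = s j"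
  shows "minor A k r s = 0"
proof -
  let ?M = "Matrix.mat k k (\<lambda>(i, j). A (r i) (s j))"
  have "Determinant.det (transpose_mat ?M) = 0"
    by (rule det_identical_rows[of _ k i j]) (use assms in \<open>auto intro!: eq_vecI\<close>)
  then show ?thesis
    unfolding minor_def by (subst (asm) det_transpose[of _ k]) auto
qed

text \<open>
  The notion of nonnegativity. Real numbers \<open>\<ge> 0\<close> and polynomials with nonnegative coefficients
  are the two instances; closure under these operations is all that the expansion of minors uses.
\<close>

locale nonneg_cone =
  fixes P :: "'a::comm_ring_1 \<Rightarrow> bool"
  assumes zero [simp, intro]: "P 0"
    and one [simp, intro]: "P 1"
    and add [intro]: "P x \<Longrightarrow> P y \<Longrightarrow> P (x + y)"
    and mult [intro]: "P x \<Longrightarrow> P y \<Longrightarrow> P (x * y)"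
begin

lemma sum_closed: "(\<And>x. x \<in> A \<Longrightarrow> P (f x)) \<Longrightarrow> P (sum f A)"
  by (induction A rule: infinite_finite_induct) auto

lemma prod_closed: "(\<And>x. x \<in> A \<Longrightarrow> P (f x)) \<Longrightarrow> P (prod f A)"
  by (induction A rule: infinite_finite_induct) auto

lemma of_nat_closed [simp, intro]: "P (of_nat n)"
  by (induction n) auto

lemma power_closed: "P x \<Longrightarrow> P (x ^ n)"
  by (induction n) auto

text \<open>
  Column choices in the expansion of a minor are only weakly increasing; ties contribute 0.
\<close>

lemma minor_weakly_increasing_columns:
  assumes TP: "all_minors P A" and r: "strict_mono_on {..<k} r"
    and s: "\<And>i j. i < j \<Longrightarrow> j < k \<Longrightarrow> s i \<le> s j"
  shows "P (minor A k r s)"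
proof (cases "strict_mono_on {..<k} s")
  case True
  then show ?thesis using TP r by (auto simp: all_minors_def)
next
  case False
  then obtain i j where "i < j" "j < k" "\<not> s i < s j"
    by (auto simp: strict_mono_on_def)
  with s[of i j] have "s i = s j" by simp
  then have "minor A k r s = 0" using minor_eq_columns \<open>i < j\<close> \<open>j < k\<close> by blast
  then show ?thesis by simp
qed

end

text \<open>
  Column \<open>j\<close> of the new matrix combines the old columns in \<open>F j\<close> with weights \<open>g j\<close>. The order
  condition allows consecutive supports to share an end point, which covers bidiagonal matrices.
\<close>

definition staircase :: "('a::comm_ring_1 \<Rightarrow> bool) \<Rightarrow> (nat \<Rightarrow> nat set) \<Rightarrow> (nat \<Rightarrow> nat \<Rightarrow> 'a) \<Rightarrow> bool"
  where "staircase P F g \<longleftrightarrow>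
    (\<forall>j. finite (F j)) \<and> (\<forall>i j. i < j \<longrightarrow> (\<forall>x\<in>F i. \<forall>y\<in>F j. x \<le> y)) \<and> (\<forall>j. \<forall>x\<in>F j. P (g j x))"

lemma permutes_nat_less: "p permutes {0..<k} \<Longrightarrow> j < k \<Longrightarrow> p j < (k::nat)"
  using permutes_in_image[of p "{0..<k}" j] by simp

text \<open>
  Multilinearity in the columns: a minor of the new matrix is a sum over all ways to choose one old
  column from each support.
\<close>

lemma minor_column_combination:
  fixes g A :: "nat \<Rightarrow> nat \<Rightarrow> 'a::comm_ring_1"
  assumes fin: "\<And>j. finite (F j)"
  shows "minor (\<lambda>i j. \<Sum>x\<in>F j. g j x * A i x) k r s =
    (\<Sum>f\<in>(\<Pi>\<^sub>E j\<in>{..<k}. F (s j)). (\<Prod>j<k. g (s j) (f j)) * minor A k r f)"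
proof -
  have "minor (\<lambda>i j. \<Sum>x\<in>F j. g j x * A i x) k r s =
      (\<Sum>p | p permutes {0..<k}. signof p * (\<Prod>j<k. \<Sum>x\<in>F (s j). g (s j) x * A (r (p j)) x))"
    unfolding minor_def
    by (subst det_col[of _ k]) (auto intro!: sum.cong prod.cong simp: permutes_nat_less)
  also have "\<dots> = (\<Sum>p | p permutes {0..<k}. signof p *
      (\<Sum>f\<in>(\<Pi>\<^sub>E j\<in>{..<k}. F (s j)). \<Prod>j<k. g (s j) (f j) * A (r (p j)) (f j)))"
    by (subst prod_sum_PiE) (auto simp: fin)
  also have "\<dots> = (\<Sum>f\<in>(\<Pi>\<^sub>E j\<in>{..<k}. F (s j)). (\<Prod>j<k. g (s j) (f j)) *
      (\<Sum>p | p permutes {0..<k}. signof p * (\<Prod>j<k. A (r (p j)) (f j))))"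
    unfolding sum_distrib_left prod.distrib
    by (subst sum.swap) (simp add: mult_ac)
  also have "\<dots> = (\<Sum>f\<in>(\<Pi>\<^sub>E j\<in>{..<k}. F (s j)). (\<Prod>j<k. g (s j) (f j)) * minor A k r f)"
    unfolding minor_def
    by (intro sum.cong refl, subst det_col[of _ k])
      (auto intro!: sum.cong prod.cong simp: permutes_nat_less)
  finally show ?thesis .
qed

text \<open>
  The order of the supports makes every choice of columns weakly increasing, so no term of the
  expansion carries a sign.
\<close>

lemma (in nonneg_cone) all_minors_staircase:
  assumes TP: "all_minors P A" and F: "staircase P F g"
  shows "all_minors P (\<lambda>i j. \<Sum>x\<in>F j. g j x * A i x)"
  unfolding all_minors_def
proof (intro allI impI, elim conjE)
  fix k and r s :: "nat \<Rightarrow> nat" assume r: "strict_mono_on {..<k} r" and s: "strict_mono_on {..<k} s"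
  have fin: "\<And>j. finite (F j)" using F by (simp add: staircase_def)
  have "P ((\<Prod>j<k. g (s j) (f j)) * minor A k r f)" if f: "f \<in> (\<Pi>\<^sub>E j\<in>{..<k}. F (s j))" for f
  proof (intro mult prod_closed minor_weakly_increasing_columns[OF TP r])
    fix j assume "j \<in> {..<k}"
    then show "P (g (s j) (f j))" using f F by (auto simp: staircase_def PiE_iff)
  next
    fix i j assume ij: "i < j" "j < k"
    then have "s i < s j" using s by (auto simp: strict_mono_on_def)
    then show "f i \<le> f j" using f F ij unfolding staircase_def PiE_iff
      by (metis lessThan_iff less_trans)
  qed
  then show "P (minor (\<lambda>i j. \<Sum>x\<in>F j. g j x * A i x) k r s)"
    unfolding minor_column_combination[OF fin] by (rule sum_closed)
qed

lemma minor_Suc: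
  "minor A (Suc k) r s = (\<Sum>j<Suc k. A (r 0) (s j) *
    ((-1) ^ j * minor A k (\<lambda>i. r (Suc i)) (\<lambda>i. s (if i < j then i else Suc i))))"
proof -
  let ?M = "Matrix.mat (Suc k) (Suc k) (\<lambda>(i, j). A (r i) (s j))"
  have "Determinant.det ?M = (\<Sum>j<Suc k. ?M $$ (0, j) * cofactor ?M 0 j)"
    by (rule laplace_expansion_row) auto
  also have "\<dots> = (\<Sum>j<Suc k. A (r 0) (s j) *
      ((-1) ^ j * minor A k (\<lambda>i. r (Suc i)) (\<lambda>i. s (if i < j then i else Suc i))))"
  proof (intro sum.cong refl)
    fix j assume j: "j \<in> {..<Suc k}"
    have "mat_delete ?M 0 j =
        Matrix.mat k k (\<lambda>(i, i'). A (r (Suc i)) (s (if i' < j then i' else Suc i')))"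
      by (rule eq_matI) (auto simp: mat_delete_def)
    then show "?M $$ (0, j) * cofactor ?M 0 j = A (r 0) (s j) *
        ((-1) ^ j * minor A k (\<lambda>i. r (Suc i)) (\<lambda>i. s (if i < j then i else Suc i)))"
      using j by (simp add: cofactor_def minor_def)
  qed
  finally show ?thesis unfolding minor_def .
qed

lemma minor_0: "minor A 0 r s = 1"
  by (simp add: minor_def)

lemma minor_first_row_unit:
  assumes "A (r 0) (s 0) = 1" "\<And>j. 0 < j \<Longrightarrow> j \<le> k \<Longrightarrow> A (r 0) (s j) = 0"
  shows "minor A (Suc k) r s = minor A k (\<lambda>i. r (Suc i)) (\<lambda>j. s (Suc j))"
proof -
  have "minor A (Suc k) r s = (\<Sum>j\<in>{0}. A (r 0) (s j) *
      ((-1) ^ j * minor A k (\<lambda>i. r (Suc i)) (\<lambda>i. s (if i < j then i else Suc i))))"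
    unfolding minor_Suc by (rule sum.mono_neutral_right) (auto simp: assms(2))
  then show ?thesis using assms(1) by simp
qed

lemma minor_first_row_zero:
  "k > 0 \<Longrightarrow> (\<And>j. j < k \<Longrightarrow> A (r 0) (s j) = 0) \<Longrightarrow> minor A k r s = 0"
  by (cases k) (simp_all add: minor_Suc)

text \<open>
  The constant polynomial 1, as a sequence of coefficients.
\<close>

definition unit_row :: "nat \<Rightarrow> 'a::comm_ring_1"
  where "unit_row j = (if j = 0 then 1 else 0)"

lemma strict_mono_on_gt_0:
  fixes s :: "nat \<Rightarrow> nat"
  assumes "strict_mono_on {..<k} s" "0 < j" "j < k"
  shows "0 < s j" 
  using assms unfolding strict_mono_on_def by (metis gr_zeroI lessThan_iff less_trans not_less_zero)

text \<open>
  A minor that uses the new row either loses this row and the column 0 by Laplace expansion, or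
  contains a zero row.
\<close>

lemma (in nonneg_cone) all_minors_prepend_unit_row:
  assumes TP: "all_minors P A"
  shows "all_minors P (case_nat unit_row A)"
  unfolding all_minors_def
proof (intro allI impI, elim conjE)
  fix k and r s :: "nat \<Rightarrow> nat" assume r: "strict_mono_on {..<k} r" and s: "strict_mono_on {..<k} s"
  let ?A = "case_nat unit_row A"
  show "P (minor ?A k r s)"
  proof (cases k)
    case 0
    then show ?thesis by (simp add: minor_def)
  next
    case (Suc l)
    have r': "r i > 0" if "0 < i" "i < k" for i using strict_mono_on_gt_0[OF r that] .
    have rest: "strict_mono_on {..<k} (\<lambda>i. r i - 1)" if "r 0 > 0"
    proof (rule strict_mono_onI)
      fix i j assume ij: "i \<in> {..<k}" "j \<in> {..<k}" "i < j"
      then have "r i < r j" using r by (auto simp: strict_mono_on_def)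
      moreover have "r i > 0" using r'[of i] that ij by (cases "i = 0") auto
      ultimately show "r i - 1 < r j - 1" by linarith
    qed
    consider "r 0 > 0" | "r 0 = 0" "s 0 = 0" | "r 0 = 0" "s 0 > 0" by blast
    then show ?thesis
    proof cases
      case 1
      have "minor ?A k r s = minor A k (\<lambda>i. r i - 1) s"
      proof (rule minor_cong)
        fix i j assume "i < k"
        then have "r i > 0" using 1 r'[of i] by (cases "i = 0") auto
        then show "?A (r i) (s j) = A (r i - 1) (s j)" by (cases "r i") auto
      qed
      then show ?thesis using TP s rest[OF 1] by (auto simp: all_minors_def)
    next
      case 2
      have "minor ?A k r s = minor ?A l (\<lambda>i. r (Suc i)) (\<lambda>j. s (Suc j))"
        unfolding Suc using 2 strict_mono_on_gt_0[OF s] Suc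
        by (intro minor_first_row_unit) (auto simp: unit_row_def)
      also have "\<dots> = minor A l (\<lambda>i. r (Suc i) - 1) (\<lambda>j. s (Suc j))"
      proof (rule minor_cong)
        fix i j assume "i < l"
        then have "r (Suc i) > 0" using r'[of "Suc i"] Suc by auto
        then show "?A (r (Suc i)) (s (Suc j)) = A (r (Suc i) - 1) (s (Suc j))"
          by (cases "r (Suc i)") auto
      qed
      also have "P \<dots>"
      proof -
        have "strict_mono_on {..<l} (\<lambda>i. r (Suc i) - 1)"
        proof (rule strict_mono_onI)
          fix i j assume ij: "i \<in> {..<l}" "j \<in> {..<l}" "i < j"
          then have "r (Suc i) < r (Suc j)" using r Suc by (auto simp: strict_mono_on_def)
          moreover have "r (Suc i) > 0" using r'[of "Suc i"] Suc ij by auto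
          ultimately show "r (Suc i) - 1 < r (Suc j) - 1" by linarith
        qed
        moreover have "strict_mono_on {..<l} (\<lambda>j. s (Suc j))"
          using s Suc by (auto simp: strict_mono_on_def)
        ultimately show ?thesis using TP by (auto simp: all_minors_def)
      qed
      finally show ?thesis .
    next
      case 3
      have "s j > 0" if "j < k" for j 
        using 3 strict_mono_on_gt_0[OF s, of j] that by (cases "j = 0") auto
      then have "minor ?A k r s = 0"
        using 3 Suc by (intro minor_first_row_zero) (auto simp: unit_row_def)
      then show ?thesis by simp
    qed
  qed
qed

text \<open>
  A staircase acts on each row of a matrix separately, so it is an operator on sequences. Compositions
  of such operators preserve total positivity although they need not be staircases themselves.
\<close>

inductive staircase_op :: "('a::comm_ring_1 \<Rightarrow> bool) \<Rightarrow> ((nat \<Rightarrow> 'a) \<Rightarrow> nat \<Rightarrow> 'a) \<Rightarrow> bool"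
  for P where
    identity: "staircase_op P (\<lambda>v. v)"
  | step: "staircase_op P U \<Longrightarrow> staircase P F g \<Longrightarrow> staircase_op P (\<lambda>v j. \<Sum>x\<in>F j. g j x * U v x)"

lemma (in nonneg_cone) all_minors_staircase_op:
  assumes "staircase_op P U" "all_minors P A"
  shows "all_minors P (\<lambda>i. U (A i))"
  using assms by (induction) (auto intro: all_minors_staircase)

lemma staircase_op_zero: "staircase_op P U \<Longrightarrow> U (\<lambda>_. 0) = (\<lambda>_. 0)"
  by (induction rule: staircase_op.induct) auto

lemma staircase_op_comp:
  "staircase_op P U \<Longrightarrow> staircase_op P V \<Longrightarrow> staircase_op P (\<lambda>v. U (V v))"
  by (induction rule: staircase_op.induct) (auto intro: staircase_op.step)

lemma staircase_op_funpow:
  "staircase_op P U \<Longrightarrow> staircase_op P (U ^^ n)"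
proof (induction n)
  case 0
  then show ?case using staircase_op.identity[of P] by (simp add: id_def)
next
  case (Suc n)
  then show ?case using staircase_op_comp[of P U "U ^^ n"] by (simp add: o_def)
qed

definition shift_op :: "nat \<Rightarrow> ((nat \<Rightarrow> 'a) \<Rightarrow> nat \<Rightarrow> 'a) \<Rightarrow> (nat \<Rightarrow> 'a) \<Rightarrow> nat \<Rightarrow> 'a"
  where "shift_op N U v j = (if j < N then v j else U (\<lambda>i. v (i + N)) (j - N))"

lemma (in nonneg_cone) staircase_op_shift:
  "staircase_op P U \<Longrightarrow> staircase_op P (shift_op N U)"
proof (induction rule: staircase_op.induct)
  case identity
  have "shift_op N (\<lambda>v. v) = (\<lambda>v :: nat \<Rightarrow> 'a. v)" by (auto simp: shift_op_def fun_eq_iff)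
  then show ?case using staircase_op.identity by metis
next
  case (step U F g)
  define F' where "F' j = (if j < N then {j} else (\<lambda>x. x + N) ` F (j - N))" for j
  define g' where "g' j x = (if j < N then 1 else g (j - N) (x - N))" for j x
  have "staircase P F' g'"
    unfolding staircase_def
  proof (intro conjI allI impI ballI)
    fix i j x y assume ij: "i < j" and x: "x \<in> F' i" and y: "y \<in> F' j"
    show "x \<le> y"
    proof (cases "i < N")
      case True
      then show ?thesis using x y ij by (auto simp: F'_def split: if_splits)
    next
      case False
      then have "i - N < j - N" using ij by auto
      then show ?thesis using x y False ij step(2) by (auto simp: F'_def staircase_def)
    qed
  qed (use step(2) in \<open>auto simp: F'_def g'_def staircase_def\<close>)
  then have "staircase_op P (\<lambda>v j. \<Sum>x\<in>F' j. g' j x * shift_op N U v x)"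
    using step.IH by (rule staircase_op.step[rotated])
  moreover have "(\<lambda>v j. \<Sum>x\<in>F' j. g' j x * shift_op N U v x) =
      shift_op N (\<lambda>v j. \<Sum>x\<in>F j. g j x * U v x)"
    by (intro ext) (auto simp: F'_def g'_def shift_op_def sum.reindex)
  ultimately show ?case by simp
qed

lemma (in nonneg_cone) all_minors_zero: "all_minors P (\<lambda>_ _. 0)"
  unfolding all_minors_def
proof (intro allI impI)
  fix k and r s :: "nat \<Rightarrow> nat"
  show "P (minor (\<lambda>_ _. 0) k r s)"
    using minor_first_row_zero[of k "\<lambda>_ _. 0 :: 'a" r s] by (cases k) (auto simp: minor_0)
qed

text \<open>
  The rows below \<open>N\<close>, completed by zero rows, form a totally positive matrix: applying \<open>U\<close> to it
  and putting the unit row on top yields the same matrix for \<open>N + 1\<close>.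
\<close>

lemma (in nonneg_cone) all_minors_production:
  assumes U: "staircase_op P U" and R0: "R 0 = unit_row" and RS: "\<And>n. R (Suc n) = U (R n)"
  shows "all_minors P R"
proof -
  define A where "A N n = (if n < N then R n else (\<lambda>_. 0))" for N n
  have A: "all_minors P (A N)" for N
  proof (induction N)
    case 0
    then show ?case using all_minors_zero by (simp add: A_def)
  next
    case (Suc N)
    have "A (Suc N) = case_nat unit_row (\<lambda>n. U (A N n))"
      by (auto simp: A_def fun_eq_iff R0 RS staircase_op_zero[OF U] split: nat.split)
    then show ?case
      using all_minors_prepend_unit_row[OF all_minors_staircase_op[OF U Suc]] by simp
  qed
  show ?thesis unfolding all_minors_def
  proof (intro allI impI, elim conjE)
    fix k and r s :: "nat \<Rightarrow> nat" assume r: "strict_mono_on {..<k} r" and s: "strict_mono_on {..<k} s"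
    obtain N where N: "\<forall>i<k. r i < N"
      using finite_nat_bounded[of "r ` {..<k}"] by (auto simp: subset_eq)
    have "minor R k r s = minor (A N) k r s"
      using N by (intro minor_cong) (auto simp: A_def)
    then show "P (minor R k r s)" using A[of N] r s by (auto simp: all_minors_def)
  qed
qed

text \<open>
  Since \<open>R (m + n) = (U ^^ n) (R m)\<close>, the Hankel matrix can be built column by column from \<open>R\<close>: keep a
  copy of the leading column of what has not been processed yet, and apply \<open>U\<close> to the rest.
  The matrix \<open>A N\<close> in the proof is the stage with \<open>N\<close> Hankel columns.
\<close>

lemma (in nonneg_cone) all_minors_Hankel_production:
  assumes U: "staircase_op P U" and R0: "R 0 = unit_row" and RS: "\<And>n. R (Suc n) = U (R n)"
  shows "all_minors P (\<lambda>m n. R (m + n) 0)"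
proof -
  define A where "A N m j = (if j < N then R (m + j) 0 else R (m + N) (j - N))" for N m j
  have A: "all_minors P (A N)" for N
  proof (induction N)
    case 0
    have "A 0 = R" by (auto simp: A_def fun_eq_iff)
    then show ?case using all_minors_production[OF assms] by simp
  next
    case (Suc N)
    have "staircase P (\<lambda>j. {if j \<le> N then j else j - 1}) (\<lambda>_ _. 1)"
      by (auto simp: staircase_def)
    from all_minors_staircase_op[OF staircase_op_shift[OF U] all_minors_staircase[OF Suc this]]
    have "all_minors P (\<lambda>m. shift_op (Suc N) U (\<lambda>j. A N m (if j \<le> N then j else j - 1)))"
      by simp
    also have "(\<lambda>m. shift_op (Suc N) U (\<lambda>j. A N m (if j \<le> N then j else j - 1))) = A (Suc N)"
      by (auto simp: A_def fun_eq_iff shift_op_def RS[symmetric] less_Suc_eq)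
    finally show ?case .
  qed
  show ?thesis unfolding all_minors_def
  proof (intro allI impI, elim conjE)
    fix k and r s :: "nat \<Rightarrow> nat" assume r: "strict_mono_on {..<k} r" and s: "strict_mono_on {..<k} s"
    obtain N where N: "\<forall>i<k. s i < N"
      using finite_nat_bounded[of "s ` {..<k}"] by (auto simp: subset_eq)
    have "minor (\<lambda>m n. R (m + n) 0) k r s = minor (A N) k r s"
      using N by (intro minor_cong) (auto simp: A_def)
    then show "P (minor (\<lambda>m n. R (m + n) 0) k r s)" using A[of N] r s by (auto simp: all_minors_def)
  qed
qed

interpretation nonneg_real: nonneg_cone "\<lambda>x::real. x \<ge> 0"
  by unfold_locales auto

lemma nonneg_cone_nonneg_poly: "nonneg_cone (nonneg_poly X)"
proof
  fix p q assume p: "nonneg_poly X p" and q: "nonneg_poly X q"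
  show "nonneg_poly X (p + q)"
    using p q keys_add[of p q] by (auto simp: nonneg_poly_def lookup_add subset_eq)
  show "nonneg_poly X (p * q)"
    unfolding nonneg_poly_def
  proof (intro conjI ballI allI)
    fix u assume "u \<in> Poly_Mapping.keys (p * q)"
    then obtain v w where "u = v + w" "v \<in> Poly_Mapping.keys p" "w \<in> Poly_Mapping.keys q" using keys_mult[of p q] by blast
    then show "Poly_Mapping.keys u \<subseteq> X" using p q keys_add[of v w] unfolding nonneg_poly_def by blast
  next
    fix u
    have "Sum_any f \<ge> 0" if "\<And>x. f x \<ge> 0" for f :: "(indet \<Rightarrow>\<^sub>0 nat) \<Rightarrow> real"
      using that by (auto simp: Sum_any.expand_set intro: sum_nonneg)
    then show "Poly_Mapping.lookup (p * q) u \<ge> 0"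
      using p q unfolding lookup_mult by (auto simp: nonneg_poly_def when_def intro!: mult_nonneg_nonneg)
  qed
qed (auto simp: nonneg_poly_def lookup_one when_def split: if_splits)

lemma nonneg_poly_Var: "v \<in> X \<Longrightarrow> nonneg_poly X (Var v)"
  by (auto simp: nonneg_poly_def Var_def lookup_single when_def)

lemma nonneg_poly_Const: "c \<ge> 0 \<Longrightarrow> nonneg_poly X (Const c)"
  by (auto simp: nonneg_poly_def Const_def lookup_single when_def split: if_splits)

section \<open>Log-convexity from Hankel minors\<close>

definition hankel_det :: "(nat \<Rightarrow> 'a::comm_ring_1) \<Rightarrow> nat \<Rightarrow> nat \<Rightarrow> 'a"
  where "hankel_det \<alpha> k p = minor (\<lambda>i j. \<alpha> (i + j)) k (\<lambda>i. p + i) (\<lambda>j. j)"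

lemma log_op_eq_hankel_det: "log_op \<alpha> (p + 1) = hankel_det \<alpha> 2 p"
  by (simp add: log_op_def hankel_det_def minor_Suc minor_0 numeral_eq_Suc power2_eq_square)

text \<open>
  The identities of Desnanot and Jacobi for the \<open>3 \<times> 3\<close> and \<open>4 \<times> 4\<close> Hankel determinants.
\<close>

lemma Dodgson_hankel_3:
  "hankel_det \<alpha> 2 p * hankel_det \<alpha> 2 (p + 2) - (hankel_det \<alpha> 2 (p + 1))\<^sup>2 =
    \<alpha> (p + 2) * hankel_det \<alpha> 3 p"
  by (simp add: hankel_det_def minor_Suc minor_0 numeral_eq_Suc) (simp add: algebra_simps)

lemma Dodgson_hankel_4:
  "hankel_det \<alpha> 3 p * hankel_det \<alpha> 3 (p + 2) - (hankel_det \<alpha> 3 (p + 1))\<^sup>2 =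
    hankel_det \<alpha> 2 (p + 2) * hankel_det \<alpha> 4 p"
  by (simp add: hankel_det_def minor_Suc minor_0 numeral_eq_Suc) (simp add: algebra_simps)

text \<open>
  Applying the operator twice gives a product of Hankel minors, which is manifestly nonnegative.
\<close>

lemma log_op_twice: "(log_op ^^ 2) \<alpha> (p + 2) = \<alpha> (p + 2) * hankel_det \<alpha> 3 p"
proof -
  have "(log_op ^^ 2) \<alpha> (p + 2) =
      log_op \<alpha> (p + 1) * log_op \<alpha> (p + 2 + 1) - (log_op \<alpha> (p + 1 + 1))\<^sup>2"
    by (simp add: numeral_2_eq_2 log_op_def[of "log_op \<alpha>"])
  then show ?thesis unfolding log_op_eq_hankel_det Dodgson_hankel_3 .
qed

text \<open>
  The second iterate at \<open>i\<close> is \<open>\<alpha> i * D i\<close> with a Hankel determinant \<open>D i\<close> of size 3. Add and subtract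
  \<open>\<alpha> (i - 1) * \<alpha> (i + 1) * (D i)\<^sup>2\<close>: one difference is a condensation of determinants of size 3, the other
  a minor of size 2 times \<open>(D i)\<^sup>2\<close>.
\<close>

lemma log_op_thrice:
  "(log_op ^^ 3) \<alpha> (p + 3) =
    \<alpha> (p + 2) * \<alpha> (p + 4) * (hankel_det \<alpha> 2 (p + 2) * hankel_det \<alpha> 4 p)
    + hankel_det \<alpha> 2 (p + 2) * (hankel_det \<alpha> 3 (p + 1))\<^sup>2"
proof -
  let ?L = "log_op ^^ 2" and ?D = "hankel_det \<alpha>"
  have "(log_op ^^ 3) \<alpha> (p + 3) =
      ?L \<alpha> (p + 2) * ?L \<alpha> ((p + 2) + 2) - (?L \<alpha> ((p + 1) + 2))\<^sup>2"
    by (simp add: numeral_3_eq_3 log_op_def[of "log_op (log_op \<alpha>)"] numeral_2_eq_2)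
  also have "\<dots> = \<alpha> (p + 2) * \<alpha> (p + 4) * (?D 3 p * ?D 3 (p + 2)) - (\<alpha> (p + 3))\<^sup>2 * (?D 3 (p + 1))\<^sup>2"
    unfolding log_op_twice by (simp add: power_mult_distrib numeral_eq_Suc mult_ac)
  also have "?D 3 p * ?D 3 (p + 2) = ?D 2 (p + 2) * ?D 4 p + (?D 3 (p + 1))\<^sup>2"
    using Dodgson_hankel_4[of \<alpha> p] by (simp add: algebra_simps)
  also have "(\<alpha> (p + 3))\<^sup>2 = \<alpha> (p + 2) * \<alpha> (p + 4) - ?D 2 (p + 2)"
    using log_op_eq_hankel_det[of \<alpha> "p + 2"] by (simp add: log_op_def numeral_eq_Suc algebra_simps)
  finally show ?thesis by (simp add: algebra_simps)
qed

lemma (in nonneg_cone) log_op_iterates_closed: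
  assumes TP: "all_minors P (\<lambda>i j. \<alpha> (i + j))" and m: "m \<le> 3" "m \<le> i"
  shows "P ((log_op ^^ m) \<alpha> i)"
proof -
  have D: "P (hankel_det \<alpha> k p)" for k p
    using TP by (auto simp: hankel_det_def all_minors_def strict_mono_on_def)
  have \<alpha>: "P (\<alpha> p)" for p
    using D[of 1 p] by (simp add: hankel_det_def minor_Suc minor_0)
  obtain p where i: "i = p + m" using m(2) by (metis le_add_diff_inverse2)
  consider "m = 0" | "m = 1" | "m = 2" | "m = 3" using m(1) by linarith
  then show ?thesis
  proof cases
    case 1
    then show ?thesis using \<alpha> by simp
  next
    case 2
    then show ?thesis using D[of 2 p] log_op_eq_hankel_det[of \<alpha> p] by (simp add: i)
  next
    case 3
    then show ?thesis using D \<alpha> log_op_twice[of \<alpha> p] by (simp add: i mult)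
  next
    case 4
    then show ?thesis unfolding i 4 log_op_thrice by (intro add mult power_closed D \<alpha>)
  qed
qed


section \<open>The triangle and its production operator\<close>

text \<open>
  The operator \<open>1 + b D\<close> on coefficient sequences, where \<open>D\<close> is the derivative.
\<close>

definition lower_op :: "'a::comm_ring_1 \<Rightarrow> (nat \<Rightarrow> 'a) \<Rightarrow> nat \<Rightarrow> 'a"
  where "lower_op b v k = v k + b * of_nat (Suc k) * v (Suc k)"

text \<open>
  The operator \<open>(u + x) (1 + b D) + y\<close> on coefficient sequences in the indeterminate \<open>u\<close>.
\<close>

definition raise_op :: "'a::comm_ring_1 \<Rightarrow> 'a \<Rightarrow> 'a \<Rightarrow> (nat \<Rightarrow> 'a) \<Rightarrow> nat \<Rightarrow> 'a"
  where "raise_op b x y v k =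
    case_nat 0 v k + (b * of_nat k + x + y) * v k + b * x * of_nat (Suc k) * v (Suc k)"

fun lah_tri :: "nat \<Rightarrow> 'a::comm_ring_1 \<Rightarrow> 'a \<Rightarrow> 'a \<Rightarrow> nat \<Rightarrow> nat \<Rightarrow> 'a"
  where
    "lah_tri a b d x 0 = unit_row"
  | "lah_tri a b d x (Suc n) =
      raise_op b x (of_nat a * b * d + of_nat a * b * of_nat n) (lah_tri a b d x n)"

lemma lah_tri_above: "k > n \<Longrightarrow> lah_tri a b d x n k = 0"
  by (induction n arbitrary: k) (auto simp: unit_row_def raise_op_def split: nat.split)

lemma lah_tri_diagonal: "lah_tri a b d x n n = 1"
  by (induction n) (auto simp: unit_row_def raise_op_def lah_tri_above)

text \<open>
  Scaling column \<open>k\<close> by \<open>c ^ k\<close> absorbs \<open>c\<close> without any division, which also covers \<open>c\<close> that are not invertible.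
\<close>

lemma generalized_lah_eq_lah_tri:
  assumes "generalized_lah a b c d lam T"
  shows "T n k = c ^ k * lah_tri a b d (c * lam) n k"
proof (induction n arbitrary: k)
  case 0
  show ?case using assms by (cases k) (auto simp: generalized_lah_def unit_row_def)
next
  case (Suc n)
  show ?case
  proof (cases k)
    case 0
    have "T (Suc n) 0 = (of_nat a * b * of_nat n + of_nat a * b * d + c * lam) * T n 0 + b * lam * T n 1"
      using assms unfolding generalized_lah_def by (metis Suc_eq_plus1 diff_Suc_1 le_add2)
    then show ?thesis unfolding 0 by (simp add: Suc.IH raise_op_def algebra_simps)
  next
    case (Suc l)
    have "T (Suc n) k = c * T n l
      + (of_nat a * b * of_nat n + b * of_nat k + of_nat a * b * d + c * lam) * T n k
      + b * lam * of_nat (k + 1) * T n (k + 1)"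
      using assms Suc unfolding generalized_lah_def by (metis Suc_eq_plus1 diff_Suc_1 le_add2)
    then show ?thesis unfolding Suc by (simp add: Suc.IH raise_op_def algebra_simps)
  qed
qed

text \<open>
  This is the commutator of \<open>1 + b D\<close> with multiplication by \<open>u\<close>, which equals \<open>b\<close>.
\<close>

lemma lower_raise_commute:
  "lower_op b (raise_op b x y v) = raise_op b x (y + b) (lower_op b v)"
proof
  show "lower_op b (raise_op b x y v) k = raise_op b x (y + b) (lower_op b v) k" for k
    by (cases k) (simp_all add: lower_op_def raise_op_def algebra_simps)
qed

lemma lower_power_raise_commute:
  "(lower_op b ^^ a) (raise_op b x y v) = raise_op b x (y + of_nat a * b) ((lower_op b ^^ a) v)"
proof (induction a)
  case (Suc a)
  then show ?case by (simp add: lower_raise_commute algebra_simps)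
qed simp

lemma raise_op_add: "raise_op b x (y + z) v k = raise_op b x y v k + z * v k"
  by (simp add: raise_op_def algebra_simps)

lemma raise_op_linear:
  "raise_op b x y (\<lambda>k. u k + z * v k) k = raise_op b x y u k + z * raise_op b x y v k"
  by (cases k) (simp_all add: raise_op_def algebra_simps)

lemma raise_op_commute: "raise_op b x y (raise_op b x z v) = raise_op b x z (raise_op b x y v)"
proof -
  have r: "raise_op b x y u = (\<lambda>k. raise_op b x 0 u k + y * u k)" for y and u :: "nat \<Rightarrow> 'a"
    using raise_op_add[of b x 0 y u] by auto
  show ?thesis
    unfolding r[of y] r[of z] raise_op_linear by (simp add: algebra_simps)
qed

lemma lower_power_unit_row: "(lower_op b ^^ a) unit_row = unit_row"
  by (induction a) (auto simp: lower_op_def unit_row_def fun_eq_iff)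

text \<open>
  Moving \<open>E ^ a\<close>, where \<open>E = 1 + b D\<close>, past a raising operator adds \<open>a b\<close> to its constant. This
  is exactly how the recurrence changes from one row to the next, so a factor \<open>E ^ a\<close> applied
  at each step accounts for the dependence on \<open>n\<close>.
\<close>

lemma lah_tri_production:
  "lah_tri a b d x (Suc n) = raise_op b x (of_nat a * b * d) ((lower_op b ^^ a) (lah_tri a b d x n))"
proof (induction n)
  case 0
  show ?case by (simp add: lower_power_unit_row)
next
  case (Suc n)
  define y where "y = of_nat a * b * d + of_nat a * b * of_nat n"
  let ?A = "raise_op b x (of_nat a * b * d)" and ?E = "lower_op b ^^ a"
  have "?A (?E (lah_tri a b d x (Suc n))) = ?A (?E (raise_op b x y (lah_tri a b d x n)))"
    by (simp add: y_def)
  also have "\<dots> = raise_op b x (y + of_nat a * b) (?A (?E (lah_tri a b d x n)))"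
    unfolding lower_power_raise_commute by (rule raise_op_commute)
  also have "\<dots> = raise_op b x (y + of_nat a * b) (lah_tri a b d x (Suc n))"
    by (simp only: Suc.IH[symmetric])
  also have "y + of_nat a * b = of_nat a * b * d + of_nat a * b * of_nat (Suc n)"
    by (simp add: y_def algebra_simps)
  finally show ?case by (simp only: lah_tri.simps)
qed

context nonneg_cone
begin

lemma staircase_op_lower:
  assumes "P b"
  shows "staircase_op P (lower_op b)"
proof -
  define g where "g j x = (if x = j then 1 else b * of_nat (Suc j))" for j x :: nat
  have "staircase P (\<lambda>j. {j, Suc j}) g"
    using assms by (auto simp: staircase_def g_def)
  from staircase_op.step[OF staircase_op.identity this]
  have "staircase_op P (\<lambda>v j. \<Sum>x\<in>{j, Suc j}. g j x * v x)" .
  also have "(\<lambda>v j. \<Sum>x\<in>{j, Suc j}. g j x * v x) = lower_op b"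
    by (auto simp: g_def lower_op_def fun_eq_iff)
  finally show ?thesis .
qed

text \<open>
  The raising operator itself is tridiagonal and need not be a product of bidiagonal matrices with
  entries in the cone. It factors through twice as many columns: column \<open>2 l\<close> holds \<open>y * v l\<close> and
  column \<open>2 l + 1\<close> holds the value of \<open>(1 + b D) v\<close> at \<open>l\<close>. In a planar network, the even columns
  are the shortcuts that carry the summand \<open>y\<close>.
\<close>

lemma staircase_op_raise:
  assumes "P b" "P x" "P y"
  shows "staircase_op P (raise_op b x y)"
proof -
  define F where "F j = (if even j then {j div 2} else {j div 2, Suc (j div 2)})" for j :: nat
  define g where "g j i = (if even j then y else if i = j div 2 then 1
    else b * of_nat (Suc (j div 2)))" for j i :: nat
  define F' where "F' k = (case k of 0 \<Rightarrow> {0, 1} | Suc l \<Rightarrow> {2 * l + 1, 2 * l + 2, 2 * l + 3})" for k :: nat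
  define g' where "g' k i = (if i = 2 * k + 1 then x else 1)" for k i :: nat
  have "staircase P F g"
    unfolding staircase_def
  proof (intro conjI allI impI ballI)
    fix i j u v assume "i < j" "u \<in> F i" "v \<in> F j"
    moreover have "i div 2 < j div 2 \<or> even i" if "i < j" 
      using that by presburger
    ultimately show "u \<le> v" by (auto simp: F_def split: if_splits)
  qed (use assms in \<open>auto simp: F_def g_def\<close>)
  moreover have "staircase P F' g'"
    using assms by (auto simp: staircase_def F'_def g'_def split: nat.splits)
  ultimately have "staircase_op P (\<lambda>v k. \<Sum>i\<in>F' k. g' k i * (\<Sum>l\<in>F i. g i l * v l))"
    using staircase_op.step[OF staircase_op.step[OF staircase_op.identity]] by blast
  also have "(\<lambda>v k. \<Sum>i\<in>F' k. g' k i * (\<Sum>l\<in>F i. g i l * v l)) = raise_op b x y"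
  proof (intro ext)
    fix v :: "nat \<Rightarrow> 'a" and k
    define N where "N i = (\<Sum>l\<in>F i. g i l * v l)" for i
    have odd: "N (2 * l + 1) = lower_op b v l" for l
      by (auto simp: N_def F_def g_def lower_op_def)
    have even: "N (2 * l) = y * v l" for l
      by (auto simp: N_def F_def g_def)
    have "(\<Sum>i\<in>F' k. g' k i * N i) = raise_op b x y v k"
    proof (cases k)
      case 0
      show ?thesis using odd[of 0] even[of 0]
        by (simp add: 0 F'_def g'_def raise_op_def lower_op_def algebra_simps)
    next
      case (Suc l)
      have "(\<Sum>i\<in>F' k. g' k i * N i) = N (2 * l + 1) + N (2 * Suc l) + x * N (2 * Suc l + 1)"
        by (simp add: Suc F'_def g'_def numeral_eq_Suc)
      then show ?thesis unfolding odd even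
        by (simp add: Suc raise_op_def lower_op_def algebra_simps)
    qed
    then show "(\<Sum>i\<in>F' k. g' k i * (\<Sum>l\<in>F i. g i l * v l)) = raise_op b x y v k"
      by (simp only: N_def)
  qed
  finally show ?thesis .
qed

lemma staircase_op_lah_production:
  assumes "P b" "P d" "P x"
  shows "staircase_op P (\<lambda>v. raise_op b x (of_nat a * b * d) ((lower_op b ^^ a) v))"
  using assms
  by (intro staircase_op_comp[OF staircase_op_raise staircase_op_funpow[OF staircase_op_lower]]) auto

lemma all_minors_generalized_lah:
  assumes T: "generalized_lah a b c d lam T" and P: "P b" "P c" "P d" "P lam"
  shows "all_minors P T"
proof -
  have "staircase P (\<lambda>k. {k}) (\<lambda>k _. c ^ k)"
    using P power_closed by (auto simp: staircase_def)
  moreover have "all_minors P (lah_tri a b d (c * lam))"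
    using P by (intro all_minors_production[OF staircase_op_lah_production, of b d "c * lam" _ a])
      (auto simp: lah_tri_production simp del: lah_tri.simps(2))
  ultimately have "all_minors P (\<lambda>n k. \<Sum>i\<in>{k}. c ^ k * lah_tri a b d (c * lam) n i)"
    by (rule all_minors_staircase[rotated])
  also have "(\<lambda>n k. \<Sum>i\<in>{k}. c ^ k * lah_tri a b d (c * lam) n i) = T"
    using generalized_lah_eq_lah_tri[OF T] by (simp add: fun_eq_iff)
  finally show ?thesis .
qed

lemma all_minors_Hankel_lah:
  assumes P: "P b" "P d" "P x"
  shows "all_minors P (\<lambda>m n. lah_tri a b d x (m + n) 0)"
  using P by (intro all_minors_Hankel_production[OF staircase_op_lah_production, of b d x _ a])
    (auto simp: lah_tri_production simp del: lah_tri.simps(2))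

end

text \<open>
  Taylor expansion: substituting \<open>u + q\<close> for \<open>u\<close> leaves \<open>D\<close> unchanged and turns \<open>u + x\<close> into
  \<open>u + (x + q)\<close>.
\<close>

lemma lah_tri_add:
  "lah_tri a b d (x + q) n k = (\<Sum>j\<le>n. lah_tri a b d x n j * (of_nat (j choose k) * q ^ (j - k)))"
proof (induction n arbitrary: k)
  case 0
  show ?case by (cases k) (auto simp: unit_row_def)
next
  case (Suc n)
  define v where "v = lah_tri a b d x n"
  define y where "y = of_nat a * b * d + of_nat a * b * of_nat n"
  define \<beta> :: "nat \<Rightarrow> nat \<Rightarrow> 'a" where "\<beta> j k = of_nat (j choose k) * q ^ (j - k)" for j k
  have v0: "v j = 0" if "j > n" for j using that by (simp add: v_def lah_tri_above)
  have \<beta>_0: "\<beta> 0 (Suc l) = 0" for l by (simp add: \<beta>_def)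
  \<comment> \<open>The next three facts say how the substitution interacts with \<open>u\<close>, \<open>D\<close> and \<open>u D\<close>.\<close>
  have pascal: "\<beta> (Suc j) k = case_nat 0 (\<beta> j) k + q * \<beta> j k" for j k
  proof (cases k)
    case (Suc l)
    consider "j < l" | "j = l" | "j > l" by linarith
    then show ?thesis
    proof cases
      case 3
      then have "j - l = Suc (j - Suc l)" by auto
      then show ?thesis unfolding Suc \<beta>_def by (simp add: algebra_simps)
    qed (auto simp: Suc \<beta>_def binomial_eq_0)
  qed (simp add: \<beta>_def)
  have deriv: "of_nat (Suc k) * \<beta> (Suc j) (Suc k) = of_nat (Suc j) * \<beta> j k" for j k
    unfolding \<beta>_def using Suc_times_binomial_eq[of j k]
    by (metis (no_types, opaque_lifting) diff_Suc_Suc mult.assoc mult.commute of_nat_mult)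
  have euler: "of_nat j * \<beta> j k = of_nat k * \<beta> j k + q * (of_nat (Suc k) * \<beta> j (Suc k))" for j k
  proof -
    consider "j < k" | "j = k" | "j > k" by linarith
    then show ?thesis
    proof cases
      case 3
      then obtain i where j: "j = Suc (k + i)" by (auto simp: less_iff_Suc_add)
      have "Suc i * (j choose k) = Suc k * (j choose Suc k)"
        using binomial_absorb_comp[of j k] binomial_absorption[of k j] j
        by (metis Suc_diff_le add_diff_cancel_left' binomial_absorption diff_Suc_1 le_add1)
      then have c: "of_nat (Suc i) * of_nat (j choose k) = (of_nat (Suc k) * of_nat (j choose Suc k) :: 'a)"
        by (metis of_nat_mult)
      have "of_nat j = (of_nat k + of_nat (Suc i) :: 'a)" by (simp add: j)
      then have "of_nat j * \<beta> j k = of_nat k * \<beta> j k + (of_nat (Suc i) * of_nat (j choose k)) * q ^ (j - k)"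
        by (simp only: \<beta>_def ring_distribs mult.assoc)
      also have "q ^ (j - k) = q * q ^ (j - Suc k)" by (simp add: j)
      finally show ?thesis unfolding c by (simp add: \<beta>_def mult_ac)
    qed (auto simp: \<beta>_def binomial_eq_0)
  qed
  define B where "B k = (\<Sum>j\<le>n. v j * \<beta> j k)" for k
  have IH: "lah_tri a b d (x + q) n = B"
    using Suc.IH by (auto simp: B_def v_def \<beta>_def fun_eq_iff)
  have "(\<Sum>j\<le>Suc n. lah_tri a b d x (Suc n) j * \<beta> j k) =
      (\<Sum>j\<le>Suc n. case_nat 0 v j * \<beta> j k) + (\<Sum>j\<le>Suc n. (b * of_nat j + x + y) * v j * \<beta> j k)
      + (\<Sum>j\<le>Suc n. b * x * of_nat (Suc j) * v (Suc j) * \<beta> j k)"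
    by (simp only: lah_tri.simps raise_op_def v_def[symmetric] y_def[symmetric] ring_distribs sum.distrib)
  also have "(\<Sum>j\<le>Suc n. case_nat 0 v j * \<beta> j k) = (\<Sum>j\<le>n. v j * \<beta> (Suc j) k)"
    by (subst sum.atMost_Suc_shift) simp
  also have "(\<Sum>j\<le>Suc n. (b * of_nat j + x + y) * v j * \<beta> j k) =
      (\<Sum>j\<le>n. (b * of_nat j + x + y) * v j * \<beta> j k)"
    by (simp add: v0)
  also have "(\<Sum>j\<le>Suc n. b * x * of_nat (Suc j) * v (Suc j) * \<beta> j k) =
      (\<Sum>j\<le>Suc n. b * x * v (Suc j) * (of_nat (Suc k) * \<beta> (Suc j) (Suc k)))"
    unfolding deriv by (intro sum.cong refl) (simp only: mult_ac)
  also have "\<dots> = (\<Sum>j\<le>Suc (Suc n). b * x * v j * (of_nat (Suc k) * \<beta> j (Suc k)))"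
    by (subst (2) sum.atMost_Suc_shift) (simp only: \<beta>_0 mult_zero_right add_0_left)
  also have "\<dots> = (\<Sum>j\<le>n. b * x * v j * (of_nat (Suc k) * \<beta> j (Suc k)))"
    by (simp add: v0)
  also have "(\<Sum>j\<le>n. v j * \<beta> (Suc j) k) + (\<Sum>j\<le>n. (b * of_nat j + x + y) * v j * \<beta> j k)
      + (\<Sum>j\<le>n. b * x * v j * (of_nat (Suc k) * \<beta> j (Suc k))) =
    (\<Sum>j\<le>n. v j * case_nat 0 (\<beta> j) k) + (\<Sum>j\<le>n. (b * of_nat k + (x + q) + y) * (v j * \<beta> j k))
      + (\<Sum>j\<le>n. b * (x + q) * of_nat (Suc k) * (v j * \<beta> j (Suc k)))"
    unfolding sum.distrib[symmetric]
  proof (intro sum.cong refl)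
    fix j
    have "v j * \<beta> (Suc j) k + (b * of_nat j + x + y) * v j * \<beta> j k
        + b * x * v j * (of_nat (Suc k) * \<beta> j (Suc k)) =
      v j * (case_nat 0 (\<beta> j) k + q * \<beta> j k) + b * v j * (of_nat j * \<beta> j k) + (x + y) * v j * \<beta> j k
        + b * x * v j * (of_nat (Suc k) * \<beta> j (Suc k))"
      by (simp only: pascal algebra_simps)
    also have "\<dots> = v j * case_nat 0 (\<beta> j) k + (b * of_nat k + (x + q) + y) * (v j * \<beta> j k)
        + b * (x + q) * of_nat (Suc k) * (v j * \<beta> j (Suc k))"
      unfolding euler[of j k] by (simp add: algebra_simps)
    finally show "v j * \<beta> (Suc j) k + (b * of_nat j + x + y) * v j * \<beta> j k
        + b * x * v j * (of_nat (Suc k) * \<beta> j (Suc k)) = \<dots>" .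
  qed
  also have "\<dots> = case_nat 0 B k + (b * of_nat k + (x + q) + y) * B k + b * (x + q) * of_nat (Suc k) * B (Suc k)"
    unfolding sum_distrib_left[symmetric] by (cases k) (simp_all add: B_def)
  also have "\<dots> = lah_tri a b d (x + q) (Suc n) k"
    by (simp add: IH raise_op_def y_def)
  finally show ?case by (simp only: \<beta>_def)
qed

text \<open>
  Evaluating a row at \<open>q\<close> is the same as substituting \<open>u + q\<close> and then taking the constant term.
\<close>

lemma row_poly_generalized_lah:
  assumes "generalized_lah a b c d lam T"
  shows "row_poly T n q = lah_tri a b d (c * (q + lam)) n 0"
proof -
  have "row_poly T n q = lah_tri a b d (c * lam + c * q) n 0"
    unfolding lah_tri_add row_poly_def generalized_lah_eq_lah_tri[OF assms]
    by (intro sum.cong refl) (simp add: power_mult_distrib mult_ac)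
  then show ?thesis by (simp add: algebra_simps)
qed

lemma first_column_generalized_lah:
  "generalized_lah a b c d lam T \<Longrightarrow> T n 0 = lah_tri a b d (c * lam) n 0"
  by (simp add: generalized_lah_eq_lah_tri)

section \<open>The branched continued fraction\<close>

lemma fps_X_dvd_if_nth_0: "fps_nth f 0 = 0 \<Longrightarrow> fps_X dvd (f :: 'a::comm_ring_1 fps)"
  by (rule dvdI[of _ _ "fps_shift 1 f"]) (auto simp: fps_eq_iff)

lemma fps_nth_eq_0_if_fps_X_power_dvd: "fps_X ^ n dvd f \<Longrightarrow> i < n \<Longrightarrow> fps_nth f i = (0 :: 'a::comm_ring_1)"
  by (auto simp: fps_X_power_mult_nth elim!: dvdE)

lemma dvd_prod_diff:
  fixes f g :: "'b \<Rightarrow> 'a::comm_ring_1"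
  assumes "\<And>i. i \<in> I \<Longrightarrow> d dvd f i - g i"
  shows "d dvd prod f I - prod g I"
  using assms
proof (induction I rule: infinite_finite_induct)
  case (insert i I)
  have "prod f (insert i I) - prod g (insert i I) =
      (f i - g i) * prod f I + g i * (prod f I - prod g I)"
    using insert by (simp add: algebra_simps)
  then show ?case using insert by simp
qed simp_all

text \<open>
  The quotient \<open>F j = H (j + 1) / H j\<close> equals \<open>1 / (1 - \<alpha> (m + j) t F (j + 1) \<dots> F (j + m))\<close>, because
  the product of the quotients telescopes to \<open>H (j + m + 1) / H (j + 1)\<close>. Each further level of the
  truncated fraction gains one correct coefficient, owing to the factor \<open>t\<close>.
\<close>

lemma branched_S_fraction_Euler_Gauss:
  fixes H :: "nat \<Rightarrow> 'a::field fps"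
  assumes H0: "H 0 = 1" and const: "\<And>j. fps_nth (H j) 0 = 1"
    and rec: "\<And>j. H (Suc j) - H j = fps_const (\<alpha> (m + j)) * fps_X * H (j + m + 1)"
  shows "is_branched_S_fraction m \<alpha> (H 1)"
proof -
  define F where "F j = H (Suc j) * inverse (H j)" for j
  have inv: "H j * inverse (H j) = 1" for j
    by (rule inverse_mult_eq_1') (simp add: const)
  have prod_F: "(\<Prod>i=1..l. F (j + i)) = H (j + l + 1) * inverse (H (j + 1))" for j l
  proof (induction l)
    case 0
    show ?case using inv[of "Suc j"] by simp
  next
    case (Suc l)
    have "(\<Prod>i=1..Suc l. F (j + i)) = (H (j + l + 1) * inverse (H (j + l + 1))) * H (j + l + 2) * inverse (H (j + 1))"
      using Suc by (simp add: F_def mult_ac)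
    then show ?case unfolding inv by simp
  qed
  define D where "D f k = 1 - fps_const (\<alpha> k) * fps_X * (\<Prod>i=1..m. f (k + i))" for f k
  have D_0: "fps_nth (D f k) 0 = 1" for f k by (simp add: D_def)
  have F: "F j = inverse (D (\<lambda>k. F (k - m)) (m + j))" for j
  proof -
    have p: "(\<Prod>i=1..m. F (m + j + i - m)) = H (j + m + 1) * inverse (H (j + 1))"
      by (subst prod_F[symmetric]) (auto intro!: prod.cong simp: ac_simps)
    have "D (\<lambda>k. F (k - m)) (m + j) * F j =
        (H (Suc j) - fps_const (\<alpha> (m + j)) * fps_X * H (j + m + 1) * (H (j + 1) * inverse (H (j + 1)))) * inverse (H j)"
      unfolding D_def p by (simp add: F_def algebra_simps)
    also have "\<dots> = (H (Suc j) - (H (Suc j) - H j)) * inverse (H j)"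
      unfolding inv rec by simp
    also have "\<dots> = 1" using inv by simp
    finally have "D (\<lambda>k. F (k - m)) (m + j) * F j = 1" .
    then show ?thesis by (metis fps_inverse_unique)
  qed
  have approx: "fps_X ^ Suc N dvd branched_trunc m \<alpha> N (m + j) - F j" for N j
  proof (induction N arbitrary: j)
    case 0
    show ?case by (auto intro!: fps_X_dvd_if_nth_0 simp: F_def const)
  next
    case (Suc N)
    define D1 D2 where "D1 = D (branched_trunc m \<alpha> N) (m + j)" and "D2 = D (\<lambda>k. F (k - m)) (m + j)"
    have "fps_X ^ Suc N dvd branched_trunc m \<alpha> N (m + j + i) - F (m + j + i - m)" for i
      using Suc[of "j + i"] by (simp add: add.assoc)
    then have "fps_X ^ Suc N dvd (\<Prod>i=1..m. branched_trunc m \<alpha> N (m + j + i)) - (\<Prod>i=1..m. F (m + j + i - m))"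
      by (intro dvd_prod_diff)
    then have "fps_X * fps_X ^ Suc N dvd
        (fps_const (\<alpha> (m + j)) * fps_X) * ((\<Prod>i=1..m. branched_trunc m \<alpha> N (m + j + i)) - (\<Prod>i=1..m. F (m + j + i - m)))"
      by (intro mult_dvd_mono) auto
    then have d: "fps_X ^ Suc (Suc N) dvd D2 - D1"
      by (simp add: D1_def D2_def D_def algebra_simps)
    have "D1 * inverse D1 = 1" "D2 * inverse D2 = 1"
      by (auto intro!: inverse_mult_eq_1' simp: D1_def D2_def D_0)
    moreover have "inverse D1 * inverse D2 * (D2 - D1) =
        inverse D1 * (D2 * inverse D2) - inverse D2 * (D1 * inverse D1)"
      by (simp only: algebra_simps)
    ultimately have "inverse D1 - inverse D2 = inverse D1 * inverse D2 * (D2 - D1)"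
      by simp
    moreover have "branched_trunc m \<alpha> (Suc N) (m + j) = inverse D1"
      using D_0[of "branched_trunc m \<alpha> N" "m + j"]
      by (simp add: D1_def D_def fps_divide_unit)
    moreover have "F j = inverse D2" unfolding D2_def by (rule F)
    ultimately show ?case using d by (metis dvd_mult)
  qed
  have "H 1 = F 0" using H0 by (simp add: F_def)
  have "(\<lambda>N. branched_trunc m \<alpha> N m) \<longlonglongrightarrow> F 0"
  proof (rule tendsto_fpsI)
    fix n
    have "fps_nth (branched_trunc m \<alpha> N m) n = fps_nth (F 0) n" if "N \<ge> n" for N
      using fps_nth_eq_0_if_fps_X_power_dvd[OF approx[of N 0], of n] that by simp
    then show "\<forall>\<^sub>F N in sequentially. fps_nth (branched_trunc m \<alpha> N m) n = fps_nth (F 0) n"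
      by (auto simp: eventually_sequentially)
  qed
  then show ?thesis unfolding is_branched_S_fraction_def \<open>H 1 = F 0\<close> .
qed

lemma lower_power_above:
  "(\<And>j. j > n \<Longrightarrow> v j = 0) \<Longrightarrow> k > n \<Longrightarrow> (lower_op b ^^ i) v k = 0"
  by (induction i arbitrary: k) (auto simp: lower_op_def)

lemma lower_power_top:
  "(\<And>j. j > n \<Longrightarrow> v j = 0) \<Longrightarrow> (lower_op b ^^ i) v n = v n"
  by (induction i) (auto simp: lower_op_def lower_power_above[of n v])

lemma raise_op_lower:
  "raise_op b x 0 v k = case_nat 0 (lower_op b v) k + x * lower_op b v k"
  by (cases k) (simp_all add: raise_op_def lower_op_def algebra_simps)

text \<open>
  \<open>G i k\<close> collects the entries in column \<open>k\<close> after \<open>i\<close> of the \<open>a + 1\<close> lowering factors. Another lowering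
  factor brings in \<open>b (k + 1) t\<close> times the series of the next column, and multiplication by \<open>u + x\<close>
  leads from column \<open>k - 1\<close> to column \<open>k\<close> with the coefficient \<open>x t\<close>.
\<close>

lemma lah_branched_S_fraction:
  fixes b x :: "'a::field"
  shows "is_branched_S_fraction (Suc a) (lah_branch_coeff (Suc a) x b)
    (Abs_fps (\<lambda>n. lah_tri a b 0 x n 0))"
proof -
  define m where "m = Suc a"
  let ?T = "lah_tri a b 0 x"
  (* The index n + k starts the series at the diagonal, where the entry is 1. *)
  define G where "G i k = Abs_fps (\<lambda>n. (lower_op b ^^ i) (?T (n + k)) k)" for i k
  define H where "H j = (case j of 0 \<Rightarrow> 1 | Suc l \<Rightarrow> G (l mod (m + 1)) (l div (m + 1)))" for j
  have T_Suc: "?T (Suc n) k = case_nat 0 ((lower_op b ^^ m) (?T n)) k + x * (lower_op b ^^ m) (?T n) k" for n k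
    unfolding lah_tri_production m_def by (cases k) (simp_all add: raise_op_lower)
  have G_0: "fps_nth (G i k) 0 = 1" for i k
    by (simp add: G_def lower_power_top lah_tri_above lah_tri_diagonal)
  have up: "G (Suc i) k - G i k = fps_const (of_nat (Suc k) * b) * fps_X * G i (Suc k)" for i k
  proof (rule fps_ext)
    show "fps_nth (G (Suc i) k - G i k) n = fps_nth (fps_const (of_nat (Suc k) * b) * fps_X * G i (Suc k)) n" for n
      by (cases n) (simp_all add: G_def lower_op_def mult.assoc lower_power_above[of k] lah_tri_above)
  qed
  have next_column: "G 0 k - (if k = 0 then 1 else G m (k - 1)) = fps_const x * fps_X * G m k" for k
  proof (rule fps_ext)
    fix n
    show "fps_nth (G 0 k - (if k = 0 then 1 else G m (k - 1))) n = fps_nth (fps_const x * fps_X * G m k) n"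
    proof (cases n)
      case 0
      then show ?thesis using G_0 by simp
    next
      case (Suc l)
      then show ?thesis
        by (cases k) (simp_all add: G_def mult.assoc T_Suc del: lah_tri.simps(2) funpow.simps)
    qed
  qed
  have "is_branched_S_fraction m (lah_branch_coeff m x b) (H 1)"
  proof (rule branched_S_fraction_Euler_Gauss)
    show "H 0 = 1" by (simp add: H_def)
    show "fps_nth (H j) 0 = 1" for j by (cases j) (simp_all add: H_def G_0)
    fix j
    define i k where "i = j mod (m + 1)" and "k = j div (m + 1)"
    have j: "j = (m + 1) * k + i" unfolding i_def k_def by (rule mult_div_mod_eq[symmetric])
    have i: "i \<le> m" using mod_less_divisor[of "m + 1" j] by (simp add: i_def)
    have H_Suc: "H (Suc ((m + 1) * k + i)) = G i k" if "i \<le> m" for i k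
    proof -
      have "((m + 1) * k + i) mod (m + 1) = i" "((m + 1) * k + i) div (m + 1) = k"
        using that by (auto simp: div_mult_self4 simp del: mult_Suc)
      then show ?thesis by (simp add: H_def del: mult_Suc)
    qed
    have coeff: "lah_branch_coeff m x b (m + j) = (if i = 0 then x else of_nat (Suc k) * b)"
      by (simp add: lah_branch_coeff_def i_def k_def)
    show "H (Suc j) - H j = fps_const (lah_branch_coeff m x b (m + j)) * fps_X * H (j + m + 1)"
    proof (cases i)
      case 0
      have "H (j + m + 1) = G m k" using H_Suc[of m k] by (simp add: j 0)
      moreover have "H j = (if k = 0 then 1 else G m (k - 1))"
      proof (cases k)
        case k: 0
        then show ?thesis using 0 by (simp add: j H_def)
      next
        case (Suc l)
        have "j = Suc ((m + 1) * l + m)" using j 0 Suc by simp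
        then show ?thesis using H_Suc[of m l] Suc by simp
      qed
      ultimately show ?thesis using H_Suc[of i k] next_column[of k] coeff i 0 j by simp
    next
      case (Suc l)
      have j1: "j = Suc ((m + 1) * k + l)" and j2: "j + m + 1 = Suc ((m + 1) * Suc k + l)"
        using j Suc by simp_all
      have "H j = G l k" unfolding j1 by (rule H_Suc) (use i Suc in simp)
      moreover have "H (j + m + 1) = G l (Suc k)" unfolding j2 by (rule H_Suc) (use i Suc in simp)
      ultimately show ?thesis using H_Suc[of i k] up[of l k] coeff i Suc j by simp
    qed
  qed
  also have "H 1 = Abs_fps (\<lambda>n. ?T n 0)" by (simp add: H_def G_def)
  finally show ?thesis by (simp only: m_def)
qed

section \<open>The explicit formula\<close>

text \<open>
  The value at \<open>i\<close> of \<open>b ^ n\<close> times a rising factorial with step \<open>a\<close>.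
\<close>

definition rising_poly :: "nat \<Rightarrow> 'a::comm_ring_1 \<Rightarrow> 'a \<Rightarrow> nat \<Rightarrow> nat \<Rightarrow> 'a"
  where "rising_poly a b d n i = (\<Prod>l<n. b * of_nat i + of_nat a * b * (d + of_nat l))"

lemma rising_poly_Suc:
  "rising_poly a b d (Suc n) i =
    (b * of_nat i + (of_nat a * b * d + of_nat a * b * of_nat n)) * rising_poly a b d n i"
  by (simp add: rising_poly_def algebra_simps)

text \<open>
  The triangle for \<open>x = 0\<close> obeys the recurrence of Newton coefficients, since multiplying a falling
  factorial of degree \<open>k\<close> in \<open>i\<close> by \<open>i\<close> raises its degree by one and adds \<open>k\<close> times itself.
\<close>

lemma rising_poly_Newton:
  "rising_poly a b d n i = (\<Sum>k\<le>n. lah_tri a b d 0 n k * (b ^ k * of_nat (fact k * (i choose k))))"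
proof (induction n)
  case 0
  show ?case by (simp add: rising_poly_def unit_row_def)
next
  case (Suc n)
  define v where "v = lah_tri a b d 0 n"
  define y where "y = of_nat a * b * d + of_nat a * b * of_nat n"
  define f :: "nat \<Rightarrow> 'a" where "f k = b ^ k * of_nat (fact k * (i choose k))" for k
  have f_Suc: "b * of_nat i * f k = f (Suc k) + b * of_nat k * f k" for k
  proof -
    have "i * (i choose k) = Suc k * (i choose Suc k) + k * (i choose k)"
    proof (cases "k \<le> i")
      case True
      have "Suc k * (i choose Suc k) = (i - k) * (i choose k)"
        by (metis binomial_absorb_comp binomial_absorption)
      then show ?thesis using True by (simp add: diff_mult_distrib)
    qed (simp add: binomial_eq_0)
    then have "fact k * (i * (i choose k)) = fact k * (Suc k * (i choose Suc k) + k * (i choose k))"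
      by (rule arg_cong)
    then have "i * (fact k * (i choose k)) = fact (Suc k) * (i choose Suc k) + k * (fact k * (i choose k))"
      unfolding fact_Suc of_nat_id by (simp only: algebra_simps)
    then have "of_nat i * of_nat (fact k * (i choose k)) =
        (of_nat (fact (Suc k) * (i choose Suc k)) + of_nat k * of_nat (fact k * (i choose k)) :: 'a)"
      by (metis of_nat_add of_nat_mult)
    then have "b * b ^ k * (of_nat i * of_nat (fact k * (i choose k))) =
        b * b ^ k * (of_nat (fact (Suc k) * (i choose Suc k)) + of_nat k * of_nat (fact k * (i choose k)))"
      by (rule arg_cong)
    then show ?thesis unfolding f_def power_Suc by (simp only: algebra_simps)
  qed
  have v0: "v k = 0" if "k > n" for k using that by (simp add: v_def lah_tri_above)
  have "rising_poly a b d (Suc n) i = (\<Sum>k\<le>n. v k * (b * of_nat i * f k) + y * v k * f k)"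
    unfolding rising_poly_Suc Suc.IH
    by (simp add: v_def y_def f_def sum_distrib_left algebra_simps)
  also have "\<dots> = (\<Sum>k\<le>n. v k * f (Suc k)) + (\<Sum>k\<le>n. (b * of_nat k + y) * v k * f k)"
    unfolding f_Suc sum.distrib[symmetric] by (intro sum.cong refl) (simp add: algebra_simps)
  also have "(\<Sum>k\<le>n. v k * f (Suc k)) = (\<Sum>k\<le>Suc n. case_nat 0 v k * f k)"
    by (subst sum.atMost_Suc_shift) simp
  also have "(\<Sum>k\<le>n. (b * of_nat k + y) * v k * f k) = (\<Sum>k\<le>Suc n. (b * of_nat k + y) * v k * f k)"
    by (simp add: v0)
  also have "(\<Sum>k\<le>Suc n. case_nat 0 v k * f k) + (\<Sum>k\<le>Suc n. (b * of_nat k + y) * v k * f k) =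
      (\<Sum>k\<le>Suc n. lah_tri a b d 0 (Suc n) k * f k)"
    unfolding sum.distrib[symmetric]
    by (intro sum.cong refl) (simp add: raise_op_def v_def[symmetric] y_def algebra_simps)
  finally show ?case by (simp only: f_def)
qed

text \<open>
  The \<open>k\<close>-th differences at 0, divided by \<open>k!\<close> and \<open>b ^ k\<close>, satisfy the recurrence of the triangle:
  this is the Leibniz rule for the difference of \<open>i\<close> times a function of \<open>i\<close>.
\<close>

lemma rising_poly_difference:
  "(\<Sum>i\<le>k. (-1) ^ (k - i) * of_nat (k choose i) * rising_poly a b d n i) =
    fact k * b ^ k * lah_tri a b d 0 n k"
proof (induction n arbitrary: k)
  case 0
  have "(\<Sum>i\<le>k. (-1) ^ (k - i) * of_nat (k choose i)) = (1 + (-1) :: 'a) ^ k"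
    by (subst binomial_ring) (intro sum.cong refl, simp add: mult.commute)
  then show ?case by (cases k) (simp_all add: rising_poly_def unit_row_def)
next
  case (Suc n)
  define y where "y = of_nat a * b * d + of_nat a * b * of_nat n"
  define R where "R = rising_poly a b d n"
  define \<delta> where "\<delta> k = (\<Sum>i\<le>k. (-1) ^ (k - i) * of_nat (k choose i) * R i)" for k
  have drop: "(\<Sum>i\<le>k. (-1) ^ (k - i) * (of_nat (k - i) * of_nat (k choose i)) * R i) =
      - of_nat k * case_nat 0 \<delta> k" for k
  proof (cases k)
    case (Suc l)
    have "(\<Sum>i\<le>k. (-1) ^ (k - i) * (of_nat (k - i) * of_nat (k choose i)) * R i) =
        (\<Sum>i\<le>l. (-1) ^ (k - i) * (of_nat (k - i) * of_nat (k choose i)) * R i)"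
      by (simp add: Suc)
    also have "\<dots> = (\<Sum>i\<le>l. - of_nat k * ((-1) ^ (l - i) * of_nat (l choose i) * R i))"
    proof (intro sum.cong refl)
      fix i assume "i \<in> {..l}"
      then have *: "(-1 :: 'a) ^ (k - i) = - ((-1) ^ (l - i))" by (simp add: Suc Suc_diff_le)
      have "(k - i) * (k choose i) = k * (l choose i)"
        using binomial_absorb_comp[of k i] by (simp add: Suc)
      then have "of_nat (k - i) * of_nat (k choose i) = (of_nat k * of_nat (l choose i) :: 'a)"
        by (metis of_nat_mult)
      then show "(-1) ^ (k - i) * (of_nat (k - i) * of_nat (k choose i)) * R i =
          - of_nat k * ((-1) ^ (l - i) * of_nat (l choose i) * R i)"
        unfolding * by (simp add: algebra_simps)
    qed
    finally show ?thesis by (simp add: \<delta>_def sum_distrib_left Suc)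
  qed simp
  have "(\<Sum>i\<le>k. (-1) ^ (k - i) * of_nat (k choose i) * rising_poly a b d (Suc n) i) =
      (\<Sum>i\<le>k. (b * of_nat k + y) * ((-1) ^ (k - i) * of_nat (k choose i) * R i)
        - b * ((-1) ^ (k - i) * (of_nat (k - i) * of_nat (k choose i)) * R i))"
  proof (intro sum.cong refl)
    fix i assume "i \<in> {..k}"
    then have *: "of_nat k = (of_nat i + of_nat (k - i) :: 'a)" by (simp flip: of_nat_add)
    show "(-1) ^ (k - i) * of_nat (k choose i) * rising_poly a b d (Suc n) i =
      (b * of_nat k + y) * ((-1) ^ (k - i) * of_nat (k choose i) * R i)
        - b * ((-1) ^ (k - i) * (of_nat (k - i) * of_nat (k choose i)) * R i)"
      unfolding rising_poly_Suc * y_def[symmetric] R_def[symmetric] by (simp add: algebra_simps)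
  qed
  also have "\<dots> = (b * of_nat k + y) * \<delta> k + b * of_nat k * case_nat 0 \<delta> k"
    unfolding sum_subtractf sum_distrib_left[symmetric] drop \<delta>_def[symmetric] by (simp add: algebra_simps)
  also have "\<dots> = fact k * b ^ k * lah_tri a b d 0 (Suc n) k"
    using Suc.IH unfolding R_def[symmetric] \<delta>_def[symmetric]
    by (cases k) (simp_all add: raise_op_def y_def algebra_simps)
  finally show ?case .
qed

text \<open>
  The constant \<open>K\<close> takes the place of \<open>a ^ n\<close>: with \<open>K = 1\<close> the same proof covers \<open>a = 0\<close>.
\<close>

lemma generalized_lah_explicit:
  fixes b :: "'k::field_char_0" and n k :: nat
  assumes T: "generalized_lah a b c d lam T" and b: "b \<noteq> 0" and K: "K \<noteq> 0"
    and G: "\<And>i. K * G i = (\<Prod>l<n. - (of_nat i + of_nat a * (d + of_nat l)))"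
  defines "S \<equiv> lah_summand G b c lam n k"
  shows "finite {j. S j \<noteq> 0} \<and> T n k = K / fact k * Sum_any S"
proof -
  let ?L = "lah_tri a b d 0 n"
  have S: "K * S j = c ^ (k + j) * lam ^ j * (fact (k + j) / fact j) * ?L (k + j)" for j
  proof -
    have W: "rising_poly a b d n i = (- b) ^ n * (K * G i)" for i
    proof -
      have "(\<Prod>l<n. b * of_nat i + of_nat a * b * (d + of_nat l)) =
          (\<Prod>l<n. (- b) * - (of_nat i + of_nat a * (d + of_nat l)))"
        by (intro prod.cong) (simp_all add: algebra_simps)
      then show ?thesis unfolding rising_poly_def G prod.distrib by simp
    qed
    have "K * S j = b powi (int n - int k - int j) * c ^ (k + j) * lam ^ j / fact j *
        (\<Sum>i\<le>k + j. (-1) ^ (n + k + j - i) * of_nat ((k + j) choose i) * (K * G i))"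
      unfolding S_def lah_summand_def sum_distrib_left
      by (intro sum.cong refl) (simp add: field_simps)
    also have "(\<Sum>i\<le>k + j. (-1) ^ (n + k + j - i) * of_nat ((k + j) choose i) * (K * G i)) =
        (\<Sum>i\<le>k + j. inverse (b ^ n) * ((-1) ^ (k + j - i) * of_nat ((k + j) choose i) * rising_poly a b d n i))"
    proof (intro sum.cong refl)
      fix i assume "i \<in> {..k + j}"
      then have "(-1 :: 'k) ^ (n + k + j - i) = (-1) ^ n * (-1) ^ (k + j - i)"
        by (simp add: add.assoc flip: power_add)
      then show "(-1) ^ (n + k + j - i) * of_nat ((k + j) choose i) * (K * G i) =
          inverse (b ^ n) * ((-1) ^ (k + j - i) * of_nat ((k + j) choose i) * rising_poly a b d n i)"
        unfolding W using b by (simp add: power_minus[of b n] field_simps)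
    qed
    also have "\<dots> = inverse (b ^ n) * (fact (k + j) * b ^ (k + j) * ?L (k + j))"
      unfolding sum_distrib_left[symmetric] rising_poly_difference ..
    also have "b powi (int n - int k - int j) = b ^ n * inverse (b ^ (k + j))"
    proof -
      have "int n - int k - int j = int n - int (k + j)" by simp
      then show ?thesis using b by (simp add: power_int_diff divide_inverse power_add del: of_nat_add)
    qed
    finally show ?thesis using b by (simp add: field_simps)
  qed
  have S0: "S j = 0" if "k + j > n" for j
  proof -
    have "K * S j = 0" unfolding S using that by (simp add: lah_tri_above)
    then show ?thesis using K by simp
  qed
  then have sub: "{j. S j \<noteq> 0} \<subseteq> {..n}" by (force simp: not_less[symmetric])
  have "T n k = c ^ k * (\<Sum>j\<le>n. ?L j * (of_nat (j choose k) * (c * lam) ^ (j - k)))"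
    unfolding generalized_lah_eq_lah_tri[OF T] using lah_tri_add[of a b d 0 "c * lam" n k] by simp
  also have "(\<Sum>j\<le>n. ?L j * (of_nat (j choose k) * (c * lam) ^ (j - k))) =
      (\<Sum>j\<in>{k..k + n}. ?L j * (of_nat (j choose k) * (c * lam) ^ (j - k)))"
    by (intro sum.mono_neutral_cong) (auto simp: lah_tri_above binomial_eq_0)
  also have "\<dots> = (\<Sum>j\<le>n. ?L (k + j) * (of_nat ((k + j) choose k) * (c * lam) ^ j))"
    by (rule sum.reindex_bij_witness[of _ "\<lambda>j. k + j" "\<lambda>j. j - k"]) auto
  also have "c ^ k * \<dots> = (\<Sum>j\<le>n. K / fact k * S j)"
    unfolding sum_distrib_left
  proof (intro sum.cong refl)
    fix j
    have "of_nat ((k + j) choose k) = (fact (k + j) / (fact k * fact j) :: 'k)"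
      by (simp add: binomial_fact)
    moreover have "K / fact k * S j = c ^ (k + j) * lam ^ j * (fact (k + j) / (fact k * fact j)) * ?L (k + j)"
      using S[of j] by (simp add: field_simps)
    ultimately show "c ^ k * (?L (k + j) * (of_nat ((k + j) choose k) * (c * lam) ^ j)) = K / fact k * S j"
      by (simp add: power_add power_mult_distrib)
  qed
  also have "\<dots> = K / fact k * Sum_any S"
    by (simp add: Sum_any.expand_superset[OF _ sub] sum_distrib_left)
  finally show ?thesis using finite_subset[OF sub] by simp
qed

section \<open>Stieltjes moment sequences\<close>

text \<open>
  Moments may be computed on any measure space, with a weight \<open>w\<close> and a nonnegative variable \<open>h\<close>:
  the measure on the half-line is the image under \<open>h\<close> of the weighted measure. Nonnegative
  integrals take care of integrability.
\<close>

lemma stieltjes_momentI: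
  assumes h: "h \<in> borel_measurable M" "\<And>x. x \<in> space M \<Longrightarrow> h x \<ge> (0::real)"
    and w: "w \<in> borel_measurable M" and s: "\<And>n. s n \<ge> 0"
    and int: "\<And>n. (\<integral>\<^sup>+x. w x * ennreal (h x ^ n) \<partial>M) = ennreal (s n)"
  shows "stieltjes_moment s"
proof -
  let ?R = "restrict_space borel {0::real..}"
  let ?N = "density M w"
  define \<mu> where "\<mu> = distr ?N ?R h"
  have hR: "h \<in> measurable ?N ?R"
    using h by (intro measurable_restrict_space2) auto
  have nn: "(\<integral>\<^sup>+x. ennreal (x ^ n) \<partial>\<mu>) = ennreal (s n)" for n
  proof -
    have "(\<lambda>x. ennreal (x ^ n)) \<in> borel_measurable ?R" by (intro measurable_restrict_space1) measurable
    then have "(\<integral>\<^sup>+x. ennreal (x ^ n) \<partial>\<mu>) = (\<integral>\<^sup>+x. ennreal (h x ^ n) \<partial>?N)"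
      unfolding \<mu>_def by (subst nn_integral_distr[OF hR]) simp_all
    also have "\<dots> = (\<integral>\<^sup>+x. w x * ennreal (h x ^ n) \<partial>M)"
      using h(1) w by (intro nn_integral_density) (simp_all add: borel_measurable_power measurable_compose[OF _ measurable_ennreal])
    finally show ?thesis using int by simp
  qed
  have meas: "(\<lambda>x. x ^ n) \<in> borel_measurable \<mu>" for n
    unfolding \<mu>_def by (simp, intro measurable_restrict_space1) measurable
  have pos: "AE x in \<mu>. 0 \<le> x ^ n" for n
    by (rule AE_I2) (auto simp: \<mu>_def space_restrict_space)
  have "integrable \<mu> (\<lambda>x. x ^ n)" for n
    using nn[of n] by (intro integrableI_nonneg[OF meas pos]) simp
  moreover have "s n = (\<integral>x. x ^ n \<partial>\<mu>)" for n
    using integral_eq_nn_integral[OF meas pos, of n] nn[of n] s[of n] by simp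
  moreover have "sets \<mu> = sets ?R" by (simp add: \<mu>_def)
  ultimately show ?thesis unfolding stieltjes_moment_def by blast
qed

lemma stieltjes_momentE:
  assumes "stieltjes_moment s"
  obtains \<mu> where "sets \<mu> = sets (restrict_space borel {0::real..})" "finite_measure \<mu>"
    "\<And>n. (\<integral>\<^sup>+x. ennreal (x ^ n) \<partial>\<mu>) = ennreal (s n)" "\<And>n. s n \<ge> 0"
proof -
  obtain \<mu> where \<mu>: "sets \<mu> = sets (restrict_space borel {0::real..})"
    and int: "\<And>k. integrable \<mu> (\<lambda>x. x ^ k)" "\<And>k. s k = (\<integral>x. x ^ k \<partial>\<mu>)"
    using assms unfolding stieltjes_moment_def by blast
  have space: "space \<mu> = {0..}" using sets_eq_imp_space_eq[OF \<mu>] by (simp add: space_restrict_space)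
  have "s n \<ge> 0" for n unfolding int(2) by (rule integral_nonneg_AE, rule AE_I2) (simp add: space)
  moreover have "(\<integral>\<^sup>+x. ennreal (x ^ n) \<partial>\<mu>) = ennreal (s n)" for n
    unfolding int(2) by (rule nn_integral_eq_integral[OF int(1)], rule AE_I2) (simp add: space)
  moreover from this[of 0] have "finite_measure \<mu>" by (intro finite_measureI) simp
  ultimately show ?thesis using \<mu> that by blast
qed

lemma stieltjes_moment_power: "r \<ge> 0 \<Longrightarrow> stieltjes_moment (\<lambda>n. r ^ n)"
  by (rule stieltjes_momentI[of "\<lambda>_. r" "count_space (UNIV :: unit set)" "\<lambda>_. 1"])
    (auto simp: nn_integral_count_space_finite)

lemma stieltjes_moment_pairE:
  assumes "stieltjes_moment s" "stieltjes_moment t"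
  obtains M :: "(real \<times> real) measure" where "space M = {0..} \<times> {0..}"
    "fst \<in> borel_measurable M" "snd \<in> borel_measurable M"
    "\<And>i j. (\<integral>\<^sup>+p. ennreal (fst p ^ i) * ennreal (snd p ^ j) \<partial>M) = ennreal (s i) * ennreal (t j)"
    "\<And>n. s n \<ge> 0" "\<And>n. t n \<ge> 0"
proof -
  obtain \<mu> where \<mu>: "sets \<mu> = sets (restrict_space borel {0::real..})" "finite_measure \<mu>"
    "\<And>n. (\<integral>\<^sup>+u. ennreal (u ^ n) \<partial>\<mu>) = ennreal (s n)" "\<And>n. s n \<ge> 0"
    using stieltjes_momentE[OF assms(1)] by blast
  obtain \<nu> where \<nu>: "sets \<nu> = sets (restrict_space borel {0::real..})" "finite_measure \<nu>"
    "\<And>n. (\<integral>\<^sup>+v. ennreal (v ^ n) \<partial>\<nu>) = ennreal (t n)" "\<And>n. t n \<ge> 0"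
    using stieltjes_momentE[OF assms(2)] by blast
  interpret \<mu>: finite_measure \<mu> by fact
  interpret \<nu>: finite_measure \<nu> by fact
  interpret pair_sigma_finite \<mu> \<nu> ..
  let ?M = "\<mu> \<Otimes>\<^sub>M \<nu>"
  have space: "space ?M = {0..} \<times> {0..}"
    using sets_eq_imp_space_eq[OF \<mu>(1)] sets_eq_imp_space_eq[OF \<nu>(1)]
    by (simp_all add: space_restrict_space space_pair_measure)
  have [measurable]: "(\<lambda>u. u) \<in> borel_measurable \<mu>" "(\<lambda>v. v) \<in> borel_measurable \<nu>"
    by (auto simp: measurable_cong_sets[OF \<mu>(1) refl] measurable_cong_sets[OF \<nu>(1) refl]
        intro: measurable_restrict_space1)
  have [measurable]: "fst \<in> borel_measurable ?M" "snd \<in> borel_measurable ?M"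
    using measurable_compose[OF measurable_fst, of "\<lambda>u. u" \<mu> borel \<nu>]
      measurable_compose[OF measurable_snd, of "\<lambda>u. u" \<nu> borel \<mu>] by simp_all
  have moments: "(\<integral>\<^sup>+p. ennreal (fst p ^ i) * ennreal (snd p ^ j) \<partial>?M) = ennreal (s i) * ennreal (t j)" for i j
  proof -
    have "(\<integral>\<^sup>+p. ennreal (fst p ^ i) * ennreal (snd p ^ j) \<partial>?M) =
        (\<integral>\<^sup>+u. \<integral>\<^sup>+v. ennreal (u ^ i) * ennreal (v ^ j) \<partial>\<nu> \<partial>\<mu>)"
      by (subst \<nu>.nn_integral_fst[symmetric]) simp_all
    also have "\<dots> = (\<integral>\<^sup>+u. ennreal (u ^ i) * ennreal (t j) \<partial>\<mu>)"
      by (intro nn_integral_cong, subst nn_integral_cmult, measurable) (simp add: \<nu>)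
    also have "\<dots> = ennreal (s i) * ennreal (t j)"
      by (subst nn_integral_multc, measurable) (simp add: \<mu>)
    finally show ?thesis .
  qed
  from that[OF space _ _ moments \<mu>(4) \<nu>(4)] show ?thesis by simp
qed

lemma stieltjes_moment_mult:
  assumes "stieltjes_moment s" "stieltjes_moment t"
  shows "stieltjes_moment (\<lambda>n. s n * t n)"
proof -
  obtain M :: "(real \<times> real) measure" where M: "space M = {0..} \<times> {0..}"
    "fst \<in> borel_measurable M" "snd \<in> borel_measurable M"
    "\<And>i j. (\<integral>\<^sup>+p. ennreal (fst p ^ i) * ennreal (snd p ^ j) \<partial>M) = ennreal (s i) * ennreal (t j)"
    "\<And>n. s n \<ge> 0" "\<And>n. t n \<ge> 0"
    using stieltjes_moment_pairE[OF assms] by blast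
  show ?thesis
  proof (rule stieltjes_momentI[of "\<lambda>p. fst p * snd p" M "\<lambda>_. 1"])
    fix n
    have "(\<integral>\<^sup>+p. 1 * ennreal ((fst p * snd p) ^ n) \<partial>M) =
        (\<integral>\<^sup>+p. ennreal (fst p ^ n) * ennreal (snd p ^ n) \<partial>M)"
      using M(1) by (intro nn_integral_cong) (auto simp: power_mult_distrib ennreal_mult)
    then show "(\<integral>\<^sup>+p. 1 * ennreal ((fst p * snd p) ^ n) \<partial>M) = ennreal (s n * t n)"
      using M by (simp add: ennreal_mult)
  qed (use M in \<open>auto intro: borel_measurable_times\<close>)
qed

text \<open>
  The sum of the representing measures represents the sum of the sequences, by monotone
  convergence.
\<close>

lemma stieltjes_moment_countable_sum:
  fixes s :: "nat \<Rightarrow> nat \<Rightarrow> real"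
  assumes s: "\<And>i. stieltjes_moment (s i)" and t: "\<And>n. t n \<ge> 0"
    and sums: "\<And>n. (suminf (\<lambda>i. ennreal (s i n))) = ennreal (t n)"
  shows "stieltjes_moment t"
proof -
  let ?R = "restrict_space borel {0::real..}"
  have "\<forall>i. \<exists>\<mu>. sets \<mu> = sets ?R \<and> (\<forall>n. (\<integral>\<^sup>+x. ennreal (x ^ n) \<partial>\<mu>) = ennreal (s i n))"
    using s by (metis stieltjes_momentE)
  then obtain \<mu> where \<mu>: "\<And>i. sets (\<mu> i) = sets ?R"
    "\<And>i n. (\<integral>\<^sup>+x. ennreal (x ^ n) \<partial>\<mu> i) = ennreal (s i n)" by metis
  define S where "S = measure_of (space ?R) (sets ?R) (\<lambda>A. suminf (\<lambda>i. emeasure (\<mu> i) A))"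
  have sets_S [measurable_cong]: "sets S = sets ?R" unfolding S_def by (rule sets.sets_measure_of_eq)
  have [measurable_cong]: "sets (\<mu> i) = sets ?R" for i by (rule \<mu>)
  have space_S: "space S = space ?R" by (rule sets_eq_imp_space_eq) (rule sets_S)
  have emeasure_S: "emeasure S A = (suminf (\<lambda>i. emeasure (\<mu> i) A))" if "A \<in> sets S" for A
    unfolding S_def
  proof (rule emeasure_measure_of_sigma)
    show "sigma_algebra (space ?R) (sets ?R)" ..
    show "positive (sets ?R) (\<lambda>A. suminf (\<lambda>i. emeasure (\<mu> i) A))" by (simp add: positive_def)
    show "countably_additive (sets ?R) (\<lambda>A. suminf (\<lambda>i. emeasure (\<mu> i) A))"
    proof (rule countably_additiveI)
      fix B :: "nat \<Rightarrow> real set"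
      assume B: "range B \<subseteq> sets ?R" "disjoint_family B"
      have "(suminf (\<lambda>j. suminf (\<lambda>i. emeasure (\<mu> i) (B j)))) = (suminf (\<lambda>i. suminf (\<lambda>j. emeasure (\<mu> i) (B j))))"
        unfolding nn_integral_count_space_nat[symmetric]
        by (rule pair_sigma_finite.Fubini') (auto simp: pair_sigma_finite_def sigma_finite_measure_count_space)
      also have "\<dots> = (suminf (\<lambda>i. emeasure (\<mu> i) (\<Union>j. B j)))"
        using B \<mu>(1) by (intro suminf_cong suminf_emeasure) auto
      finally show "(suminf (\<lambda>j. suminf (\<lambda>i. emeasure (\<mu> i) (B j)))) = (suminf (\<lambda>i. emeasure (\<mu> i) (\<Union>j. B j)))" .
    qed
    show "A \<in> sets ?R" using that sets_S by simp
  qed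
  have integral_S: "(\<integral>\<^sup>+x. f x \<partial>S) = (suminf (\<lambda>i. \<integral>\<^sup>+x. f x \<partial>\<mu> i))" if "f \<in> borel_measurable S" for f
    using that
  proof (induction rule: borel_measurable_induct)
    case (cong f g)
    have "space (\<mu> i) = space S" for i
      using sets_eq_imp_space_eq[OF \<mu>(1)[of i]] space_S by simp
    then have "integral\<^sup>N (\<mu> i) f = integral\<^sup>N (\<mu> i) g" for i
      using cong(3) by (intro nn_integral_cong) simp
    moreover have "integral\<^sup>N S f = integral\<^sup>N S g"
      using cong(3) by (intro nn_integral_cong)
    ultimately show ?case using cong(4) by simp
  next
    case (set A)
    then show ?case using sets_S \<mu>(1) by (simp add: emeasure_S)
  next
    case (mult u c)
    then show ?case by (simp add: nn_integral_cmult ennreal_suminf_cmult)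
  next
    case (add u v)
    then show ?case by (simp add: nn_integral_add suminf_add[symmetric])
  next
    case (seq U)
    have "(\<integral>\<^sup>+x. (SUP i. U i) x \<partial>S) = (SUP i. \<integral>\<^sup>+x. U i x \<partial>S)"
      using seq by (simp add: nn_integral_monotone_convergence_SUP image_image)
    also have "\<dots> = (SUP i. suminf (\<lambda>j. \<integral>\<^sup>+x. U i x \<partial>\<mu> j))" using seq by simp
    also have "\<dots> = (suminf (\<lambda>j. SUP i. \<integral>\<^sup>+x. U i x \<partial>\<mu> j))"
      using seq(3) by (intro ennreal_suminf_SUP_eq[symmetric] incseq_nn_integral)
    also have "\<dots> = (suminf (\<lambda>j. \<integral>\<^sup>+x. (SUP i. U i) x \<partial>\<mu> j))"
      using seq by (intro suminf_cong) (simp add: nn_integral_monotone_convergence_SUP image_image)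
    finally show ?case .
  qed
  show ?thesis
  proof (rule stieltjes_momentI[of "\<lambda>x. x" S "\<lambda>_. 1"])
    show "(\<integral>\<^sup>+x. 1 * ennreal (x ^ n) \<partial>S) = ennreal (t n)" for n
    proof -
      have "(\<lambda>x. ennreal (x ^ n)) \<in> borel_measurable S"
        unfolding measurable_cong_sets[OF sets_S refl] by (intro measurable_restrict_space1) measurable
      from integral_S[OF this] show ?thesis by (simp add: \<mu> sums)
    qed
    show "(\<lambda>x. x) \<in> borel_measurable S"
      unfolding measurable_cong_sets[OF sets_S refl] by (intro measurable_restrict_space1) measurable
  qed (use t space_S in \<open>auto simp: space_restrict_space\<close>)
qed

text \<open>
  In the main case these are the moments of \<open>s\<close> times a gamma variable of shape \<open>r / s\<close>; for \<open>s = 0\<close> or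
  \<open>r = 0\<close> the measure degenerates to a point mass.
\<close>

lemma stieltjes_moment_rising:
  assumes "r \<ge> 0" "s \<ge> 0"
  shows "stieltjes_moment (\<lambda>n. \<Prod>l<n. r + s * of_nat l)"
proof -
  consider "s = 0" | "r = 0" | "r > 0" "s > 0" using assms by linarith
  then show ?thesis
  proof cases
    case 1
    then show ?thesis using stieltjes_moment_power[OF assms(1)] by simp
  next
    case 2
    have "(\<Prod>l<n. r + s * of_nat l) = 0 ^ n" for n
      using 2 by (cases n) (simp_all add: prod.lessThan_Suc_shift del: prod.lessThan_Suc)
    then show ?thesis using stieltjes_moment_power[of 0] by simp
  next
    case 3
    define z where "z = r / s"
    have z: "z > 0" using 3 by (simp add: z_def)
    have rising: "(\<Prod>l<n. r + s * of_nat l) = s ^ n * (Gamma (z + of_nat n) / Gamma z)" for n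
    proof -
      have "(\<Prod>l<n. r + s * of_nat l) = (\<Prod>l<n. s * (z + of_nat l))"
        using 3 by (intro prod.cong) (simp_all add: z_def field_simps)
      also have "\<dots> = s ^ n * pochhammer z n" by (simp add: prod.distrib pochhammer_prod atLeast0LessThan)
      also have "pochhammer z n = Gamma (z + of_nat n) / Gamma z"
        using z by (intro pochhammer_Gamma) (auto elim!: nonpos_Ints_cases)
      finally show ?thesis .
    qed
    have G: "Gamma z > 0" using z by (rule Gamma_real_pos)
    show ?thesis
    proof (rule stieltjes_momentI[of "\<lambda>t. s * \<bar>t\<bar>" lborel
          "\<lambda>t. ennreal (indicator {0..} t * t powr (z - 1) / exp t / Gamma z)"])
      fix n
      have "(\<integral>\<^sup>+t. ennreal (indicator {0..} t * t powr (z - 1) / exp t / Gamma z) * ennreal ((s * \<bar>t\<bar>) ^ n) \<partial>lborel) =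
          (\<integral>\<^sup>+t. ennreal (s ^ n / Gamma z) * ennreal (indicator {0..} t * t powr (z + of_nat n - 1) / exp t) \<partial>lborel)"
      proof (intro nn_integral_cong)
        fix t :: real
        show "ennreal (indicator {0..} t * t powr (z - 1) / exp t / Gamma z) * ennreal ((s * \<bar>t\<bar>) ^ n) =
            ennreal (s ^ n / Gamma z) * ennreal (indicator {0..} t * t powr (z + of_nat n - 1) / exp t)"
        proof (cases "t > 0")
          case True
          have "t powr (z + of_nat n - 1) = t powr (z - 1) * t ^ n"
            using True by (simp add: powr_add[symmetric] powr_realpow[symmetric] algebra_simps)
          then show ?thesis using True G 3
            by (simp add: ennreal_mult[symmetric] power_mult_distrib field_simps)
        qed (use G in \<open>cases "t = 0"; simp\<close>)
      qed
      also have "\<dots> = ennreal (s ^ n / Gamma z) * ennreal (Gamma (z + of_nat n))"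
        using z by (subst nn_integral_cmult) (auto simp: Gamma_conv_nn_integral_real)
      also have "\<dots> = ennreal (\<Prod>l<n. r + s * of_nat l)"
        using 3 G Gamma_real_pos[of "z + of_nat n"] z unfolding rising by (simp add: ennreal_mult[symmetric])
      finally show "(\<integral>\<^sup>+t. ennreal (indicator {0..} t * t powr (z - 1) / exp t / Gamma z) * ennreal ((s * \<bar>t\<bar>) ^ n) \<partial>lborel) =
        ennreal (\<Prod>l<n. r + s * of_nat l)" .
    qed (use assms in \<open>auto intro!: prod_nonneg\<close>)
  qed
qed

text \<open>
  The \<open>k\<close>-th factorial moment of a Poisson variable with mean \<open>t\<close> is \<open>t ^ k\<close>, so the Newton
  expansion averages to the expansion of the first column in powers of \<open>x = b t\<close>.
\<close>

lemma lah_tri_Dobinski: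
  fixes a :: nat and b d t :: real
  shows "(\<lambda>N. exp (- t) * t ^ N / fact N * rising_poly a b d n N) sums lah_tri a b d (b * t) n 0"
proof -
  have one: "(\<lambda>N. exp (- t) * t ^ N / fact N * real (fact k * (N choose k))) sums t ^ k" for k
  proof -
    have "(\<lambda>N. t ^ N / fact N) sums exp t"
      using exp_converges[of t] by (simp add: divide_inverse mult.commute)
    then have "(\<lambda>N. exp (- t) * t ^ k * (t ^ N / fact N)) sums (exp (- t) * t ^ k * exp t)"
      by (rule sums_mult)
    moreover have "exp (- t) * t ^ k * exp t = t ^ k" by (simp add: exp_minus)
    moreover have "exp (- t) * t ^ k * (t ^ N / fact N) =
        exp (- t) * t ^ (N + k) / fact (N + k) * real (fact k * ((N + k) choose k))" for N
      by (simp add: binomial_fact power_add)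
    ultimately have "(\<lambda>N. exp (- t) * t ^ (N + k) / fact (N + k) * real (fact k * ((N + k) choose k))) sums t ^ k"
      by simp
    moreover have "(\<Sum>N<k. exp (- t) * t ^ N / fact N * real (fact k * (N choose k))) = 0"
      by (intro sum.neutral) (simp add: binomial_eq_0)
    ultimately show ?thesis
      using sums_iff_shift'[of "\<lambda>N. exp (- t) * t ^ N / fact N * real (fact k * (N choose k))" k "t ^ k"]
      by simp
  qed
  have "(\<lambda>N. \<Sum>k\<le>n. lah_tri a b d 0 n k * b ^ k * (exp (- t) * t ^ N / fact N * real (fact k * (N choose k)))) sums
      (\<Sum>k\<le>n. lah_tri a b d 0 n k * b ^ k * t ^ k)"
    by (intro sums_sum sums_mult one)
  moreover have "(\<Sum>k\<le>n. lah_tri a b d 0 n k * b ^ k * t ^ k) = lah_tri a b d (b * t) n 0"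
    using lah_tri_add[of a b d 0 "b * t" n 0] by (simp add: power_mult_distrib mult.assoc)
  moreover have "(\<Sum>k\<le>n. lah_tri a b d 0 n k * b ^ k * (exp (- t) * t ^ N / fact N * real (fact k * (N choose k)))) =
      exp (- t) * t ^ N / fact N * rising_poly a b d n N" for N
    unfolding rising_poly_Newton sum_distrib_left by (intro sum.cong) (simp_all add: mult_ac)
  ultimately show ?thesis by simp
qed


lemma (in nonneg_cone) lah_tri_closed:
  assumes "P b" "P d" "P x"
  shows "P (lah_tri a b d x n k)"
proof (induction n arbitrary: k)
  case 0
  show ?case by (simp add: unit_row_def)
next
  case (Suc n)
  have "P (case_nat 0 (lah_tri a b d x n) k)" using Suc by (cases k) auto
  then show ?case using assms Suc unfolding lah_tri.simps raise_op_def by (intro add mult of_nat_closed)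
qed

lemma stieltjes_moment_rising_poly:
  assumes "b \<ge> 0" "d \<ge> 0"
  shows "stieltjes_moment (\<lambda>n. rising_poly a b d n N)"
proof -
  have "rising_poly a b d n N = (\<Prod>l<n. (b * real N + real a * b * d) + real a * b * real l)" for n
    unfolding rising_poly_def by (intro prod.cong) (simp_all add: algebra_simps)
  then show ?thesis using stieltjes_moment_rising[of "b * real N + real a * b * d" "real a * b"] assms by simp
qed

lemma poisson_weight_le_1:
  assumes "t \<ge> (0::real)"
  shows "exp (- t) * t ^ N / fact N \<le> 1"
proof -
  have "(\<lambda>N. t ^ N / fact N) sums exp t"
    using exp_converges[of t] by (simp add: divide_inverse mult.commute)
  then have "t ^ N / fact N \<le> exp t"
    using sum_le_suminf[of "\<lambda>N. t ^ N / fact N" "{N}"] assms by (auto simp: sums_iff)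
  then have "exp (- t) * (t ^ N / fact N) \<le> exp (- t) * exp t" by (intro mult_left_mono) auto
  then show ?thesis by (simp add: exp_minus)
qed

text \<open>
  Let \<open>x\<close> and \<open>y\<close> be represented by measures in variables \<open>u\<close> and \<open>v\<close>. Then \<open>z n\<close> is the integral of
  \<open>v ^ n * T_n(u / v)\<close> over the product measure. Where \<open>v > 0\<close>, the Dobinski formula with mean
  \<open>t = u / v + lam\<close> splits this into a series over \<open>N\<close>; each term is a gamma moment sequence, independent
  of \<open>u\<close> and \<open>v\<close>, times the moments of \<open>v\<close> under the Poisson weight \<open>w N\<close>. Where \<open>v = 0\<close>, only the
  diagonal entry \<open>b ^ n\<close> contributes, and \<open>(b u) ^ n\<close> remains.
\<close>

lemma preserves_stieltjes_generalized_lah: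
  assumes b: "b \<ge> 0" and d: "d \<ge> 0" and lam: "lam \<ge> 0" and T: "generalized_lah a b b d lam T"
  shows "preserves_stieltjes T"
  unfolding preserves_stieltjes_def
proof (intro allI impI, elim conjE)
  fix x y assume "stieltjes_moment x" "stieltjes_moment y"
  obtain M :: "(real \<times> real) measure" where space: "space M = {0..} \<times> {0..}"
    and [measurable]: "fst \<in> borel_measurable M" "snd \<in> borel_measurable M"
    and moments: "\<And>i j. (\<integral>\<^sup>+p. ennreal (fst p ^ i) * ennreal (snd p ^ j) \<partial>M) = ennreal (x i) * ennreal (y j)"
    and x: "\<And>n. x n \<ge> 0" and y: "\<And>n. y n \<ge> 0"
    using stieltjes_moment_pairE[OF \<open>stieltjes_moment x\<close> \<open>stieltjes_moment y\<close>] by blast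
  define z where "z n = (\<Sum>k\<le>n. T n k * x k * y (n - k))" for n
  have T_nonneg: "T n k \<ge> 0" for n k
    unfolding generalized_lah_eq_lah_tri[OF T] using b d lam nonneg_real.lah_tri_closed[of b d "b * lam" a n k]
    by simp
  define w where "w N p = (if snd p = 0 then 0 else
    exp (- (fst p / snd p + lam)) * (fst p / snd p + lam) ^ N / fact N)" for N and p :: "real \<times> real"
  have w_meas [measurable]: "w N \<in> borel_measurable M" for N unfolding w_def by measurable
  have w_nonneg: "w N p \<ge> 0" and w_le_1: "w N p \<le> 1" if "p \<in> space M" for N p
  proof -
    have "fst p / snd p + lam \<ge> 0" using that lam by (auto simp: space)
    then show "w N p \<ge> 0" "w N p \<le> 1"
      using poisson_weight_le_1[of "fst p / snd p + lam" N] by (auto simp: w_def)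
  qed
  define w0 where "w0 p = (if snd p = 0 then 1 else 0 :: real)" for p :: "real \<times> real"
  have w0_meas [measurable]: "w0 \<in> borel_measurable M" unfolding w0_def by measurable
  define m where "m N n = enn2real (\<integral>\<^sup>+p. ennreal (w N p) * ennreal (snd p ^ n) \<partial>M)" for N n
  define e where "e n = enn2real (\<integral>\<^sup>+p. ennreal (w0 p) * ennreal ((b * fst p) ^ n) \<partial>M)" for n
  (* The Poisson weight is at most 1, so these moments are dominated by those of the second factor. *)
  have m: "(\<integral>\<^sup>+p. ennreal (w N p) * ennreal (snd p ^ n) \<partial>M) = ennreal (m N n)" for N n
  proof -
    have "(\<integral>\<^sup>+p. ennreal (w N p) * ennreal (snd p ^ n) \<partial>M) \<le> (\<integral>\<^sup>+p. ennreal (fst p ^ 0) * ennreal (snd p ^ n) \<partial>M)"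
      using w_le_1 by (intro nn_integral_mono mult_right_mono) auto
    also have "\<dots> < \<infinity>" unfolding moments by (simp add: ennreal_mult_less_top)
    finally show ?thesis by (simp add: m_def)
  qed
  have e: "(\<integral>\<^sup>+p. ennreal (w0 p) * ennreal ((b * fst p) ^ n) \<partial>M) = ennreal (e n)" for n
  proof -
    have "(\<integral>\<^sup>+p. ennreal (w0 p) * ennreal ((b * fst p) ^ n) \<partial>M) \<le>
        (\<integral>\<^sup>+p. ennreal (b ^ n) * (ennreal (fst p ^ n) * ennreal (snd p ^ 0)) \<partial>M)"
      using b by (intro nn_integral_mono) (auto simp: w0_def power_mult_distrib space ennreal_mult)
    also have "\<dots> = ennreal (b ^ n) * (ennreal (x n) * ennreal (y 0))"
      by (subst nn_integral_cmult) (simp_all only: moments, measurable)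
    also have "\<dots> < \<infinity>" by (simp add: ennreal_mult_less_top)
    finally show ?thesis by (simp add: e_def)
  qed
  define s where "s i n = (case i of 0 \<Rightarrow> e n | Suc N \<Rightarrow> rising_poly a b d n N * m N n)" for i n
  have rising_nonneg: "rising_poly a b d n N \<ge> 0" for n N
    unfolding rising_poly_def using b d by (intro prod_nonneg) auto
  have "stieltjes_moment z"
  proof (rule stieltjes_moment_countable_sum)
    show "stieltjes_moment (s i)" for i
    proof (cases i)
      case 0
      have "stieltjes_moment e"
        by (rule stieltjes_momentI[of "\<lambda>p. b * fst p" M "\<lambda>p. ennreal (w0 p)"])
          (use b in \<open>auto simp: e space, auto simp: e_def\<close>)
      moreover have "s 0 = e" by (simp add: s_def fun_eq_iff)
      ultimately show ?thesis by (simp add: 0)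
    next
      case (Suc N)
      have "stieltjes_moment (m N)"
        by (rule stieltjes_momentI[of snd M "\<lambda>p. ennreal (w N p)"])
          (auto simp: m space, auto simp: m_def)
      then have "stieltjes_moment (\<lambda>n. rising_poly a b d n N * m N n)"
        by (rule stieltjes_moment_mult[OF stieltjes_moment_rising_poly[OF b d]])
      moreover have "s (Suc N) = (\<lambda>n. rising_poly a b d n N * m N n)"
        by (simp add: s_def fun_eq_iff)
      ultimately show ?thesis by (simp add: Suc)
    qed
    show "z n \<ge> 0" for n unfolding z_def using T_nonneg x y by (intro sum_nonneg) auto
    show "suminf (\<lambda>i. ennreal (s i n)) = ennreal (z n)" for n
    proof -
      have pointwise: "(\<Sum>k\<le>n. ennreal (T n k) * (ennreal (fst p ^ k) * ennreal (snd p ^ (n - k)))) =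
          ennreal (w0 p) * ennreal ((b * fst p) ^ n) +
          suminf (\<lambda>N. ennreal (rising_poly a b d n N) * (ennreal (w N p) * ennreal (snd p ^ n)))"
        if p: "p \<in> space M" for p
      proof -
        obtain u v where uv: "p = (u, v)" "u \<ge> 0" "v \<ge> 0" using p by (auto simp: space)
        have "(\<Sum>k\<le>n. ennreal (T n k) * (ennreal (u ^ k) * ennreal (v ^ (n - k)))) =
            ennreal (\<Sum>k\<le>n. T n k * (u ^ k * v ^ (n - k)))"
          using T_nonneg uv by (subst sum_ennreal[symmetric]) (auto simp: ennreal_mult)
        also have "\<dots> = ennreal (w0 p) * ennreal ((b * u) ^ n) +
          suminf (\<lambda>N. ennreal (rising_poly a b d n N) * (ennreal (w N p) * ennreal (v ^ n)))"
        proof (cases "v = 0")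
          case True
          have "(\<Sum>k\<le>n. T n k * (u ^ k * v ^ (n - k))) = (\<Sum>k\<in>{n}. T n k * (u ^ k * v ^ (n - k)))"
            using True by (intro sum.mono_neutral_right) auto
          then show ?thesis
            using True by (simp add: uv w0_def w_def generalized_lah_eq_lah_tri[OF T] lah_tri_diagonal power_mult_distrib)
        next
          case False
          then have v: "v > 0" using uv by simp
          define t where "t = u / v + lam"
          have t: "t \<ge> 0" using uv lam by (simp add: t_def)
          have "(\<Sum>k\<le>n. T n k * (u ^ k * v ^ (n - k))) = v ^ n * row_poly T n (u / v)"
            unfolding row_poly_def sum_distrib_left
            using v by (intro sum.cong refl) (simp add: power_divide power_diff)
          also have "row_poly T n (u / v) = lah_tri a b d (b * t) n 0"
            unfolding row_poly_generalized_lah[OF T] t_def ..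
          finally have F: "(\<Sum>k\<le>n. T n k * (u ^ k * v ^ (n - k))) = v ^ n * lah_tri a b d (b * t) n 0" .
          have "(\<lambda>N. v ^ n * (exp (- t) * t ^ N / fact N * rising_poly a b d n N)) sums
              (v ^ n * lah_tri a b d (b * t) n 0)"
            by (rule sums_mult[OF lah_tri_Dobinski])
          then have "suminf (\<lambda>N. ennreal (v ^ n * (exp (- t) * t ^ N / fact N * rising_poly a b d n N))) =
              ennreal (v ^ n * lah_tri a b d (b * t) n 0)"
            using v t rising_nonneg by (intro suminf_ennreal_eq) auto
          moreover have "ennreal (v ^ n * (exp (- t) * t ^ N / fact N * rising_poly a b d n N)) =
              ennreal (rising_poly a b d n N) * (ennreal (w N p) * ennreal (v ^ n))" for N
            using v t rising_nonneg[of n N]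
            by (simp add: uv w_def t_def[symmetric] ennreal_mult[symmetric] mult_ac)
          ultimately show ?thesis using v by (simp add: F uv w0_def)
        qed
        finally show ?thesis by (simp add: uv)
      qed
      have "ennreal (z n) = (\<Sum>k\<le>n. ennreal (T n k) * (ennreal (x k) * ennreal (y (n - k))))"
        unfolding z_def using T_nonneg x y
        by (subst sum_ennreal[symmetric]) (auto simp: ennreal_mult mult.assoc)
      also have "\<dots> = (\<Sum>k\<le>n. \<integral>\<^sup>+p. ennreal (T n k) * (ennreal (fst p ^ k) * ennreal (snd p ^ (n - k))) \<partial>M)"
        by (intro sum.cong refl) (subst nn_integral_cmult, measurable, simp add: moments)
      also have "\<dots> = (\<integral>\<^sup>+p. (\<Sum>k\<le>n. ennreal (T n k) * (ennreal (fst p ^ k) * ennreal (snd p ^ (n - k)))) \<partial>M)"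
        by (intro nn_integral_sum[symmetric]) measurable
      also have "\<dots> = (\<integral>\<^sup>+p. ennreal (w0 p) * ennreal ((b * fst p) ^ n) +
          suminf (\<lambda>N. ennreal (rising_poly a b d n N) * (ennreal (w N p) * ennreal (snd p ^ n))) \<partial>M)"
        by (rule nn_integral_cong) (rule pointwise)
      also have "\<dots> = ennreal (e n) + suminf (\<lambda>N. ennreal (rising_poly a b d n N) * ennreal (m N n))"
        by (simp add: nn_integral_add nn_integral_suminf nn_integral_cmult m e)
      also have "\<dots> = ennreal (s 0 n) + suminf (\<lambda>N. ennreal (s (Suc N) n))"
        using rising_nonneg by (simp add: s_def ennreal_mult m_def)
      also have "\<dots> = suminf (\<lambda>i. ennreal (s i n))"
        using sums_Suc[of "\<lambda>i. ennreal (s i n)", OF summable_sums[OF summableI]]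
        by (simp add: sums_iff add.commute)
      finally show ?thesis ..
    qed
  qed
  then show "stieltjes_moment (\<lambda>n. \<Sum>k\<le>n. T n k * x k * y (n - k))" by (simp add: z_def[abs_def])
qed

text \<open>
  The product also covers \<open>a = 0\<close>, where both sides are \<open>b ^ n\<close>.
\<close>

lemma fps_nth_lah_root:
  "fact n * fps_nth (lah_root_fps a b) n = (\<Prod>l<n. b + of_nat a * b * of_nat l)"
proof (cases "a = 0")
  case True
  then show ?thesis by (simp add: lah_root_fps_def)
next
  case False
  have "- (fps_const (of_nat a * b) * fps_X) = fps_const (- (of_nat a * b)) * fps_X"
    by (simp flip: fps_const_neg)
  then have "fps_nth (lah_root_fps a b) n = (- (of_nat a * b)) ^ n * ((- 1 / of_nat a) gchoose n)"
    using False by (simp add: lah_root_fps_def fps_compose_linear)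
  also have "(- 1 / real a) gchoose n = (\<Prod>l<n. - 1 / real a - real l) / fact n"
    by (simp add: gbinomial_prod_rev atLeast0LessThan)
  finally have "fact n * fps_nth (lah_root_fps a b) n =
      (\<Prod>l<n. - (of_nat a * b)) * (\<Prod>l<n. - 1 / real a - real l)" by simp
  also have "\<dots> = (\<Prod>l<n. b + of_nat a * b * of_nat l)"
    unfolding prod.distrib[symmetric] using False by (intro prod.cong) (simp_all add: field_simps)
  finally show ?thesis .
qed

lemma stieltjes_moment_lah_root:
  assumes b: "b > 0"
    and f: "Abs_fps (\<lambda>n. if n = 0 then 0 else f n / fact n) = (lah_root_fps a b - 1) / fps_const b"
  shows "stieltjes_moment (\<lambda>n. f (n + 1))"
proof -
  have "f (n + 1) = (\<Prod>l<n. (b + of_nat a * b) + of_nat a * b * of_nat l)" for n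
  proof -
    have "(lah_root_fps a b - 1) / fps_const b = (lah_root_fps a b - 1) * fps_const (inverse b)"
      using b by (simp add: fps_divide_unit fps_const_inverse)
    then have "fps_nth (Abs_fps (\<lambda>n. if n = 0 then 0 else f n / fact n)) (n + 1) =
        fps_nth (lah_root_fps a b) (n + 1) / b"
      using f by (simp add: divide_inverse)
    then have coeff: "f (n + 1) / fact (n + 1) = fps_nth (lah_root_fps a b) (n + 1) / b"
      by simp
    have "f (n + 1) = fact (n + 1) * (f (n + 1) / fact (n + 1))" by simp
    also have "\<dots> = (fact (n + 1) * fps_nth (lah_root_fps a b) (n + 1)) / b"
      unfolding coeff by simp
    also have "\<dots> = (\<Prod>l<n. (b + of_nat a * b) + of_nat a * b * of_nat l)"
      unfolding fps_nth_lah_root using b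
      by (simp add: prod.lessThan_Suc_shift algebra_simps del: prod.lessThan_Suc)
    finally show ?thesis .
  qed
  then show ?thesis using stieltjes_moment_rising[of "b + of_nat a * b" "of_nat a * b"] b by simp
qed

section \<open>Real-rooted rows\<close>

abbreviation complex_poly :: "real poly \<Rightarrow> complex poly"
  where "complex_poly \<equiv> map_poly complex_of_real"

lemma complex_poly_add: "complex_poly (p + q) = complex_poly p + complex_poly q"
  by (rule poly_eqI) (simp add: coeff_map_poly)

lemma complex_poly_mult: "complex_poly (p * q) = complex_poly p * complex_poly q"
  by (rule poly_eqI) (simp add: coeff_map_poly coeff_mult)

lemma complex_poly_of_real: "poly (complex_poly p) (of_real x) = of_real (poly p x)"
  by (induction p) (auto simp: map_poly_pCons)

text \<open>
  Split off a root provided by the fundamental theorem of algebra; by hypothesis it is real and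
  \<open>\<le> 0\<close>.
\<close>

lemma monic_split_if_real_nonpos_roots:
  fixes p :: "real poly"
  assumes "lead_coeff p = 1" "\<And>z. poly (complex_poly p) z = 0 \<Longrightarrow> Im z = 0"
    "\<And>x. x > 0 \<Longrightarrow> poly p x \<noteq> 0"
  shows "\<exists>rs. (\<forall>r\<in>set rs. r \<ge> 0) \<and> p = (\<Prod>r\<leftarrow>rs. [:r, 1:])"
  using assms
proof (induction "degree p" arbitrary: p)
  case 0
  then have "p = 1" by (metis degree_eq_zeroE lead_coeff_pCons(2) one_pCons pCons_0_0 degree_pCons_0 coeff_pCons_0)
  then show ?case by (intro exI[of _ "[]"]) simp
next
  case (Suc n)
  have "degree (complex_poly p) = Suc n" using Suc by (simp add: degree_map_poly)
  then have "\<not> constant (poly (complex_poly p))" by (simp add: constant_degree)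
  then obtain z where z: "poly (complex_poly p) z = 0" using fundamental_theorem_of_algebra by blast
  then have "z = of_real (Re z)" using Suc.prems(2) by (simp add: complex_eq_iff)
  then have "poly p (Re z) = 0" using z 
    by (metis complex_poly_of_real of_real_eq_0_iff)
  then obtain q where q: "p = [:- Re z, 1:] * q" by (auto simp: poly_eq_0_iff_dvd)
  have "Re z \<le> 0" using Suc.prems(3)[of "Re z"] \<open>poly p (Re z) = 0\<close> by force
  have "q \<noteq> 0" using q Suc.prems(1) by auto
  then have "degree p = Suc (degree q)" unfolding q by (subst degree_mult_eq) auto
  moreover have "lead_coeff q = 1" using Suc.prems(1) unfolding q lead_coeff_mult by simp
  moreover have "Im w = 0" if "poly (complex_poly q) w = 0" for w
  proof (rule Suc.prems(2))
    have "complex_poly p = complex_poly [:- Re z, 1:] * complex_poly q" unfolding q by (rule complex_poly_mult)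
    then show "poly (complex_poly p) w = 0" using that by simp
  qed
  moreover have "poly q x \<noteq> 0" if "x > 0" for x using Suc.prems(3)[OF that] by (auto simp: q)
  ultimately obtain rs where "\<forall>r\<in>set rs. r \<ge> 0" "q = (\<Prod>r\<leftarrow>rs. [:r, 1:])"
    using Suc.hyps(1)[of q] Suc.hyps(2) by auto
  then show ?case using \<open>Re z \<le> 0\<close> q by (intro exI[of _ "- Re z # rs"]) auto
qed

text \<open>
  The quotient is the sum of the terms \<open>z / (z + r)\<close>, and the imaginary part of each of them is
  \<open>r / \<bar>z + r\<bar>\<^sup>2\<close> times that of \<open>z\<close>.
\<close>

lemma log_derivative_split:
  assumes rs: "\<forall>r\<in>set rs. r \<ge> 0" and z: "Im z \<noteq> 0"
  defines "p \<equiv> (\<Prod>r\<leftarrow>rs. [:r, 1:])"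
  shows "poly (complex_poly p) z \<noteq> 0 \<and>
    Im z * Im (z * poly (complex_poly (pderiv p)) z / poly (complex_poly p) z) \<ge> 0"
  using rs unfolding p_def
proof (induction rs)
  case Nil
  show ?case by (simp add: map_poly_1')
next
  case (Cons r rs)
  let ?p = "\<Prod>r\<leftarrow>rs. [:r, 1:]"
  define P P' where "P = poly (complex_poly ?p) z" and "P' = poly (complex_poly (pderiv ?p)) z"
  have IH: "P \<noteq> 0" "Im z * Im (z * P' / P) \<ge> 0" using Cons by (auto simp: P_def P'_def)
  have zr: "of_real r + z \<noteq> 0" using z by (auto simp: complex_eq_iff)
  have 1: "poly (complex_poly (\<Prod>r\<leftarrow>r # rs. [:r, 1:])) z = (of_real r + z) * P"
    by (simp add: complex_poly_mult map_poly_pCons P_def del: mult_pCons_left)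
  have 2: "poly (complex_poly (pderiv (\<Prod>r\<leftarrow>r # rs. [:r, 1:]))) z = (of_real r + z) * P' + P"
    by (simp add: complex_poly_mult complex_poly_add pderiv_mult pderiv_pCons map_poly_pCons P_def P'_def
        del: mult_pCons_left)
  have "z * ((of_real r + z) * P' + P) / ((of_real r + z) * P) = z * P' / P + z / (of_real r + z)"
    using zr IH(1) by (simp add: field_simps)
  moreover have "Im z * Im (z / (of_real r + z)) \<ge> 0"
  proof -
    have "Im (z / (of_real r + z)) = r * Im z / ((r + Re z)\<^sup>2 + (Im z)\<^sup>2)"
      by (simp add: Im_divide algebra_simps)
    then have "Im z * Im (z / (of_real r + z)) = r * (Im z)\<^sup>2 / ((r + Re z)\<^sup>2 + (Im z)\<^sup>2)"
      by (simp add: power2_eq_square)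
    then show ?thesis using Cons.prems by simp
  qed
  ultimately show ?case using zr IH unfolding 1 2 by (simp add: distrib_left)
qed

lemma split_positive:
  assumes rs: "\<forall>r\<in>set rs. r \<ge> 0" and x: "(x::real) > 0"
  shows "poly (\<Prod>r\<leftarrow>rs. [:r, 1:]) x > 0 \<and> poly (pderiv (\<Prod>r\<leftarrow>rs. [:r, 1:])) x \<ge> 0"
  using rs
proof (induction rs)
  case (Cons r rs)
  then show ?case using x
    by (auto simp: pderiv_mult pderiv_pCons intro!: add_nonneg_nonneg simp del: mult_pCons_left)
qed simp

text \<open>
  At a root \<open>z\<close> of the new polynomial, \<open>y + z + b (z p' / p)\<close> vanishes. Off the real axis
  the imaginary parts of \<open>z\<close> and of \<open>z p' / p\<close> do not have opposite signs, so they cannot cancel.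
  For \<open>x > 0\<close> all terms of the new polynomial are nonnegative and \<open>x p(x)\<close> is positive.
\<close>

lemma split_Euler_step:
  fixes y b :: real
  assumes rs: "\<forall>r\<in>set rs. r \<ge> 0" and y: "y \<ge> 0" and b: "b \<ge> 0"
  defines "p \<equiv> (\<Prod>r\<leftarrow>rs. [:r, 1:])"
  shows "\<exists>rs'. (\<forall>r\<in>set rs'. r \<ge> 0) \<and> [:y, 1:] * p + [:0, b:] * pderiv p = (\<Prod>r\<leftarrow>rs'. [:r, 1:])"
proof (rule monic_split_if_real_nonpos_roots)
  let ?g = "[:y, 1:] * p + [:0, b:] * pderiv p"
  have monic: "lead_coeff p = 1" unfolding p_def
    by (induction rs) (auto simp: lead_coeff_mult simp del: mult_pCons_left)
  then have p0: "p \<noteq> 0" by auto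
  have deg1: "degree ([:y, 1:] * p) = Suc (degree p)" using p0 by (subst degree_mult_eq) auto
  have deg2: "degree ([:0, b:] * pderiv p) < Suc (degree p)"
  proof (cases "degree p = 0")
    case True
    then show ?thesis by (simp add: pderiv_eq_0_iff[THEN iffD2])
  next
    case False
    have "degree ([:0, b:] * pderiv p) \<le> degree [:0, b:] + degree (pderiv p)" by (rule degree_mult_le)
    also have "\<dots> \<le> 1 + (degree p - 1)" by (intro add_mono) (auto simp: degree_pderiv)
    finally show ?thesis using False by simp
  qed
  have "degree ?g = Suc (degree p)" using deg1 deg2 by (subst degree_add_eq_left) auto
  then have "lead_coeff ?g = coeff ([:y, 1:] * p) (Suc (degree p)) + coeff ([:0, b:] * pderiv p) (Suc (degree p))"
    by simp
  also have "\<dots> = lead_coeff ([:y, 1:] * p)" using deg1 coeff_eq_0[OF deg2] by simp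
  also have "\<dots> = 1" using monic by (simp add: lead_coeff_mult del: mult_pCons_left)
  finally show "lead_coeff ?g = 1" .
  show "poly ?g x \<noteq> 0" if "x > 0" for x
  proof -
    have "poly p x > 0" "poly (pderiv p) x \<ge> 0" using split_positive[OF rs that] by (auto simp: p_def)
    moreover from this have "(y + x) * poly p x > 0" "(b * x) * poly (pderiv p) x \<ge> 0" using y b that
      by (auto intro!: mult_pos_pos mult_nonneg_nonneg)
    ultimately show ?thesis by (simp add: algebra_simps)
  qed
  show "Im z = 0" if "poly (complex_poly ?g) z = 0" for z
  proof (rule ccontr)
    assume z: "Im z \<noteq> 0"
    define P P' where "P = poly (complex_poly p) z" and "P' = poly (complex_poly (pderiv p)) z"
    have P: "P \<noteq> 0" "Im z * Im (z * P' / P) \<ge> 0"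
      using log_derivative_split[OF rs z] by (auto simp: P_def P'_def p_def)
    have "0 = (of_real y + z) * P + of_real b * z * P'"
      using that unfolding complex_poly_add complex_poly_mult P_def P'_def
      by (simp add: map_poly_pCons algebra_simps)
    also have "\<dots> = P * (of_real y + z + of_real b * (z * P' / P))" using P(1) by (simp add: field_simps)
    finally have "of_real y + z + of_real b * (z * P' / P) = 0" using P(1) by simp
    then have "Im z * Im (of_real y + z + of_real b * (z * P' / P)) = 0" by simp
    moreover have "Im (of_real b * w) = b * Im w" for w :: complex by simp
    ultimately have "(Im z)\<^sup>2 + b * (Im z * Im (z * P' / P)) = 0"
      by (simp only: plus_complex.sel Im_complex_of_real power2_eq_square algebra_simps)
    moreover have "b * (Im z * Im (z * P' / P)) \<ge> 0" using b P(2) by simp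
    moreover have "(Im z)\<^sup>2 > 0" using z by simp
    ultimately show False by linarith
  qed
qed

definition lah_poly :: "nat \<Rightarrow> real \<Rightarrow> real \<Rightarrow> nat \<Rightarrow> real poly"
  where "lah_poly a b d n = (\<Sum>k\<le>n. monom (lah_tri a b d 0 n k) k)"

lemma coeff_lah_poly: "coeff (lah_poly a b d n) k = lah_tri a b d 0 n k"
  by (simp add: lah_poly_def coeff_sum lah_tri_above)

lemma lah_poly_split:
  assumes "b \<ge> 0" "d \<ge> 0"
  shows "\<exists>rs. (\<forall>r\<in>set rs. r \<ge> 0) \<and> lah_poly a b d n = (\<Prod>r\<leftarrow>rs. [:r, 1:])"
proof (induction n)
  case 0
  have "lah_poly a b d 0 = 1" by (simp add: lah_poly_def unit_row_def monom_0)
  then show ?case by (intro exI[of _ "[]"]) simp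
next
  case (Suc n)
  define y where "y = of_nat a * b * d + of_nat a * b * of_nat n"
  have "lah_poly a b d (Suc n) = [:y, 1:] * lah_poly a b d n + [:0, b:] * pderiv (lah_poly a b d n)"
  proof (rule poly_eqI)
    show "coeff (lah_poly a b d (Suc n)) k =
        coeff ([:y, 1:] * lah_poly a b d n + [:0, b:] * pderiv (lah_poly a b d n)) k" for k
      by (cases k) (simp_all add: coeff_lah_poly raise_op_def coeff_pderiv y_def algebra_simps)
  qed
  moreover have "y \<ge> 0" using assms by (simp add: y_def)
  ultimately show ?case using Suc split_Euler_step[OF _ \<open>y \<ge> 0\<close> assms(1)] by metis
qed

lemma coeff_pcompose_lah_poly:
  assumes "generalized_lah a b c d lam T"
  shows "coeff (pcompose (lah_poly a b d n) [:c * lam, c:]) k = T n k"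
proof -
  have "pcompose (lah_poly a b d n) [:c * lam, c:] = (\<Sum>k\<le>n. monom (T n k) k)"
  proof (rule poly_eq_poly_eq_iff[THEN iffD1])
    show "poly (pcompose (lah_poly a b d n) [:c * lam, c:]) = poly (\<Sum>k\<le>n. monom (T n k) k)"
    proof
      fix q
      have "poly (pcompose (lah_poly a b d n) [:c * lam, c:]) q = lah_tri a b d (0 + c * (q + lam)) n 0"
        unfolding lah_tri_add by (simp add: poly_pcompose lah_poly_def poly_sum poly_monom algebra_simps)
      also have "\<dots> = row_poly T n q" using row_poly_generalized_lah[OF assms] by simp
      also have "\<dots> = poly (\<Sum>k\<le>n. monom (T n k) k) q" by (simp add: row_poly_def poly_sum poly_monom)
      finally show "poly (pcompose (lah_poly a b d n) [:c * lam, c:]) q = poly (\<Sum>k\<le>n. monom (T n k) k) q" .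
    qed
  qed
  then show ?thesis using assms by (simp add: coeff_sum generalized_lah_def)
qed

definition toeplitz :: "real poly \<Rightarrow> nat \<Rightarrow> nat \<Rightarrow> real"
  where "toeplitz p i j = (if j \<le> i then coeff p (i - j) else 0)"

text \<open>
  The identity matrix is produced row by row by the shift of sequences, which is a staircase with
  an empty first support.
\<close>

lemma all_minors_toeplitz_1: "all_minors (\<lambda>x. x \<ge> 0) (toeplitz 1)"
proof (rule nonneg_real.all_minors_production)
  have "staircase (\<lambda>x. (x::real) \<ge> 0) (\<lambda>j. case j of 0 \<Rightarrow> {} | Suc i \<Rightarrow> {i}) (\<lambda>_ _. 1)"
    by (auto simp: staircase_def split: nat.splits)
  from staircase_op.step[OF staircase_op.identity this]
  show "staircase_op (\<lambda>x. (x::real) \<ge> 0) (\<lambda>v j. \<Sum>x\<in>(case j of 0 \<Rightarrow> {} | Suc i \<Rightarrow> {i}). 1 * v x)" .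
  show "toeplitz 1 0 = unit_row" by (auto simp: toeplitz_def unit_row_def fun_eq_iff)
  show "toeplitz 1 (Suc n) = (\<lambda>j. \<Sum>x\<in>(case j of 0 \<Rightarrow> {} | Suc i \<Rightarrow> {i}). 1 * toeplitz 1 n x)" for n
    by (auto simp: toeplitz_def fun_eq_iff split: nat.split)
qed

lemma all_minors_toeplitz_linear_factor:
  assumes "all_minors (\<lambda>x. x \<ge> 0) (toeplitz p)" "r \<ge> 0" "s \<ge> 0"
  shows "all_minors (\<lambda>x. x \<ge> 0) (toeplitz ([:r, s:] * p))"
proof -
  have "staircase (\<lambda>x. (x::real) \<ge> 0) (\<lambda>j. {j, Suc j}) (\<lambda>j x. if x = j then r else s)"
    using assms by (auto simp: staircase_def)
  from nonneg_real.all_minors_staircase[OF assms(1) this]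
  have "all_minors (\<lambda>x. x \<ge> 0) (\<lambda>i j. \<Sum>x\<in>{j, Suc j}. (if x = j then r else s) * toeplitz p i x)" .
  also have "(\<lambda>i j. \<Sum>x\<in>{j, Suc j}. (if x = j then r else s) * toeplitz p i x) = toeplitz ([:r, s:] * p)"
  proof (intro ext)
    fix i j
    show "(\<Sum>x\<in>{j, Suc j}. (if x = j then r else s) * toeplitz p i x) = toeplitz ([:r, s:] * p) i j"
    proof (cases "j < i")
      case True
      then obtain l where "i = Suc (j + l)" by (auto simp: less_iff_Suc_add)
      then show ?thesis by (simp add: toeplitz_def)
    qed (auto simp: toeplitz_def)
  qed
  finally show ?thesis .
qed

lemma all_minors_toeplitz_split:
  assumes "\<forall>r\<in>set rs. r \<ge> 0" "c \<ge> 0" "e \<ge> 0"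
  shows "all_minors (\<lambda>x. x \<ge> 0) (toeplitz (pcompose (\<Prod>r\<leftarrow>rs. [:r, 1:]) [:e, c:]))"
  using assms(1)
proof (induction rs)
  case Nil
  show ?case using all_minors_toeplitz_1 by (simp add: pcompose_1)
next
  case (Cons r rs)
  have "pcompose (\<Prod>r\<leftarrow>r # rs. [:r, 1:]) [:e, c:] = [:r + e, c:] * pcompose (\<Prod>r\<leftarrow>rs. [:r, 1:]) [:e, c:]"
    by (simp add: pcompose_mult pcompose_pCons del: mult_pCons_left)
  then show ?case using Cons assms all_minors_toeplitz_linear_factor[of _ "r + e" c] by simp
qed

text \<open>
  The row polynomial arises from that for \<open>x = 0\<close> by substituting \<open>c q + c lam\<close>, which turns its linear
  factors with nonnegative coefficients into such factors.
\<close>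

lemma PF_seq_generalized_lah:
  assumes "b \<ge> 0" "c \<ge> 0" "d \<ge> 0" "lam \<ge> 0" and T: "generalized_lah a b c d lam T"
  shows "PF_seq n (T n)"
proof -
  obtain rs where "\<forall>r\<in>set rs. r \<ge> 0" "lah_poly a b d n = (\<Prod>r\<leftarrow>rs. [:r, 1:])"
    using lah_poly_split[OF assms(1,3)] by blast
  then have "all_minors (\<lambda>x. x \<ge> 0) (toeplitz (pcompose (lah_poly a b d n) [:c * lam, c:]))"
    using assms all_minors_toeplitz_split[of rs c "c * lam"] by simp
  also have "toeplitz (pcompose (lah_poly a b d n) [:c * lam, c:]) =
      (\<lambda>i j. if j \<le> i \<and> i - j \<le> n then T n (i - j) else 0)"
    using T by (auto simp: toeplitz_def coeff_pcompose_lah_poly[OF T] fun_eq_iff generalized_lah_def)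
  finally show ?thesis by (simp add: PF_seq_def TP_def)
qed

section \<open>Properties of generalized Lah triangles\<close>

theorem proposition4p7:
  fixes a :: nat
  shows
   "(\<comment> \<open>(i), over every field of characteristic 0; for \<open>a = 0\<close> with the limit
         \<open>(-i) ^ n\<close> of \<open>a ^ n * ffact (- (i + a * d) / a) n\<close>\<close>
     \<forall>(b::'k::field_char_0) c d lam T n k.
       generalized_lah a b c d lam T \<and> b \<noteq> 0 \<and> n \<ge> 1 \<and> k \<ge> 1 \<longrightarrow>
       (a > 0 \<longrightarrow>
         (let S = lah_summand (\<lambda>i. ffact (- ((of_nat i + of_nat a * d) / of_nat a)) n) b c lam n k
          in finite {j. S j \<noteq> 0} \<and> T n k = of_nat a ^ n / fact k * Sum_any S)) \<and>
       (a = 0 \<longrightarrow>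
         (let S = lah_summand (\<lambda>i. (- of_nat i) ^ n) b c lam n k
          in finite {j. S j \<noteq> 0} \<and> T n k = 1 / fact k * Sum_any S)))
  \<and> (\<comment> \<open>(ii)\<close>
     \<forall>(d::nat) (c::real) T.
       c > 0 \<and> generalized_lah a (Var Ind_b) (Const c) (of_nat d) (Var Ind_lam) T \<longrightarrow>
       poly_TP {Ind_b, Ind_lam} T)
  \<and> (\<comment> \<open>(iii)\<close>
     \<forall>T. generalized_lah a (Var Ind_b) (Var Ind_b) (Var Ind_d) (Var Ind_lam) T \<longrightarrow>
       poly_TP {Ind_b, Ind_d, Ind_lam} T)
  \<and> (\<comment> \<open>(iv)\<close>
     \<forall>T. generalized_lah a (Var Ind_b) (Var Ind_b) (Var Ind_d) (Var Ind_lam) T \<longrightarrow>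
       poly_SM {Ind_b, Ind_d, Ind_lam, Ind_q} (\<lambda>n. row_poly T n (Var Ind_q)) \<and>
       poly_log_convex {Ind_b, Ind_d, Ind_lam, Ind_q} 3 (\<lambda>n. row_poly T n (Var Ind_q)) \<and>
       poly_SM {Ind_b, Ind_d, Ind_lam} (\<lambda>n. T n 0) \<and>
       poly_log_convex {Ind_b, Ind_d, Ind_lam} 3 (\<lambda>n. T n 0))
  \<and> (\<comment> \<open>(v)\<close>
     \<forall>(b::real) (f::nat \<Rightarrow> real).
       b > 0 \<and>
       Abs_fps (\<lambda>n. if n = 0 then 0 else f n / fact n) = (lah_root_fps a b - 1) / fps_const b \<longrightarrow>
       stieltjes_moment (\<lambda>n. f (n + 1)))
  \<and> (\<comment> \<open>(vi)\<close>
     \<forall>(b::real) d lam T.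
       b \<ge> 0 \<and> d \<ge> 0 \<and> lam \<ge> 0 \<and> generalized_lah a b b d lam T \<longrightarrow> preserves_stieltjes T)
  \<and> (\<comment> \<open>(vii)\<close>
     \<forall>(b::'k::field_char_0) c lam q T m.
       a + 1 = m \<and> generalized_lah a b c 0 lam T \<longrightarrow>
       is_branched_S_fraction m (lah_branch_coeff m (c * (q + lam)) b)
         (Abs_fps (\<lambda>n. row_poly T n q)) \<and>
       is_branched_S_fraction m (lah_branch_coeff m (c * lam) b) (Abs_fps (\<lambda>n. T n 0)))
  \<and> (\<comment> \<open>(viii)\<close>
     \<forall>(b::real) c d lam T n.
       b \<ge> 0 \<and> c \<ge> 0 \<and> d \<ge> 0 \<and> lam \<ge> 0 \<and> generalized_lah a b c d lam T \<longrightarrow>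
       PF_seq n (T n))"
proof (intro conjI)
  show "\<forall>(b::'k::field_char_0) c d lam T n k.
       generalized_lah a b c d lam T \<and> b \<noteq> 0 \<and> n \<ge> 1 \<and> k \<ge> 1 \<longrightarrow>
       (a > 0 \<longrightarrow>
         (let S = lah_summand (\<lambda>i. ffact (- ((of_nat i + of_nat a * d) / of_nat a)) n) b c lam n k
          in finite {j. S j \<noteq> 0} \<and> T n k = of_nat a ^ n / fact k * Sum_any S)) \<and>
       (a = 0 \<longrightarrow>
         (let S = lah_summand (\<lambda>i. (- of_nat i) ^ n) b c lam n k
          in finite {j. S j \<noteq> 0} \<and> T n k = 1 / fact k * Sum_any S))"
  proof (intro allI impI, elim conjE, intro conjI impI)
    fix b c d lam :: 'k and T and n k :: nat
    assume T: "generalized_lah a b c d lam T" and b: "b \<noteq> 0" 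
    {
      assume a: "a > 0"
      have "of_nat a ^ n * ffact (- ((of_nat i + of_nat a * d) / of_nat a)) n =
          (\<Prod>l<n. - (of_nat i + of_nat a * (d + of_nat l)))" for i
      proof -
        have "of_nat a ^ n * ffact (- ((of_nat i + of_nat a * d) / of_nat a)) n =
            (\<Prod>l<n. of_nat a) * (\<Prod>l<n. - ((of_nat i + of_nat a * d) / of_nat a) - of_nat l)"
          by (simp add: ffact_def)
        also have "\<dots> = (\<Prod>l<n. - (of_nat i + of_nat a * (d + of_nat l)))"
          unfolding prod.distrib[symmetric] using a by (intro prod.cong refl) (simp add: field_simps)
        finally show ?thesis .
      qed
      from generalized_lah_explicit[OF T b _ this, of k] a
      show "let S = lah_summand (\<lambda>i. ffact (- ((of_nat i + of_nat a * d) / of_nat a)) n) b c lam n k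
          in finite {j. S j \<noteq> 0} \<and> T n k = of_nat a ^ n / fact k * Sum_any S"
        by (simp add: Let_def)
    next
      assume a: "a = 0"
      have "1 * (- of_nat i) ^ n = (\<Prod>l<n. - (of_nat i + of_nat a * (d + of_nat l)))" for i
        using a by simp
      from generalized_lah_explicit[OF T b _ this, of k]
      show "let S = lah_summand (\<lambda>i. (- of_nat i) ^ n) b c lam n k
          in finite {j. S j \<noteq> 0} \<and> T n k = 1 / fact k * Sum_any S"
        by (simp add: Let_def)
    }
  qed
next
  show "\<forall>(d::nat) (c::real) T.
       c > 0 \<and> generalized_lah a (Var Ind_b) (Const c) (of_nat d) (Var Ind_lam) T \<longrightarrow>
       poly_TP {Ind_b, Ind_lam} T"
  proof (intro allI impI, elim conjE)
    fix d :: nat and c :: real and T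
    assume c: "c > 0" and T: "generalized_lah a (Var Ind_b) (Const c) (of_nat d) (Var Ind_lam) T"
    interpret nonneg_cone "nonneg_poly {Ind_b, Ind_lam}" by (rule nonneg_cone_nonneg_poly)
    show "poly_TP {Ind_b, Ind_lam} T" unfolding poly_TP_def
      using c by (intro all_minors_generalized_lah[OF T] nonneg_poly_Var nonneg_poly_Const of_nat_closed) auto
  qed
next
  show "\<forall>T. generalized_lah a (Var Ind_b) (Var Ind_b) (Var Ind_d) (Var Ind_lam) T \<longrightarrow>
       poly_TP {Ind_b, Ind_d, Ind_lam} T"
  proof (intro allI impI)
    fix T assume T: "generalized_lah a (Var Ind_b) (Var Ind_b) (Var Ind_d) (Var Ind_lam) T"
    interpret nonneg_cone "nonneg_poly {Ind_b, Ind_d, Ind_lam}" by (rule nonneg_cone_nonneg_poly)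
    show "poly_TP {Ind_b, Ind_d, Ind_lam} T" unfolding poly_TP_def
      by (intro all_minors_generalized_lah[OF T] nonneg_poly_Var) auto
  qed
next
  show "\<forall>T. generalized_lah a (Var Ind_b) (Var Ind_b) (Var Ind_d) (Var Ind_lam) T \<longrightarrow>
       poly_SM {Ind_b, Ind_d, Ind_lam, Ind_q} (\<lambda>n. row_poly T n (Var Ind_q)) \<and>
       poly_log_convex {Ind_b, Ind_d, Ind_lam, Ind_q} 3 (\<lambda>n. row_poly T n (Var Ind_q)) \<and>
       poly_SM {Ind_b, Ind_d, Ind_lam} (\<lambda>n. T n 0) \<and>
       poly_log_convex {Ind_b, Ind_d, Ind_lam} 3 (\<lambda>n. T n 0)"
  proof (intro allI impI)
    fix T assume T: "generalized_lah a (Var Ind_b) (Var Ind_b) (Var Ind_d) (Var Ind_lam) T"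
    have *: "poly_SM X (\<lambda>n. lah_tri a (Var Ind_b) (Var Ind_d) x n 0) \<and>
        poly_log_convex X 3 (\<lambda>n. lah_tri a (Var Ind_b) (Var Ind_d) x n 0)"
      if "Ind_b \<in> X" "Ind_d \<in> X" "nonneg_poly X x" for X x
    proof -
      interpret nonneg_cone "nonneg_poly X" by (rule nonneg_cone_nonneg_poly)
      have "all_minors (nonneg_poly X) (\<lambda>m n. lah_tri a (Var Ind_b) (Var Ind_d) x (m + n) 0)"
        using that by (intro all_minors_Hankel_lah nonneg_poly_Var)
      then show ?thesis
        using log_op_iterates_closed by (auto simp: poly_SM_def poly_TP_def poly_log_convex_def)
    qed
    interpret q: nonneg_cone "nonneg_poly {Ind_b, Ind_d, Ind_lam, Ind_q}" by (rule nonneg_cone_nonneg_poly)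
    interpret nonneg_cone "nonneg_poly {Ind_b, Ind_d, Ind_lam}" by (rule nonneg_cone_nonneg_poly)
    have "nonneg_poly {Ind_b, Ind_d, Ind_lam, Ind_q} (Var Ind_b * (Var Ind_q + Var Ind_lam))"
      by (intro q.mult q.add nonneg_poly_Var) auto
    moreover have "nonneg_poly {Ind_b, Ind_d, Ind_lam} (Var Ind_b * Var Ind_lam)"
      by (intro mult nonneg_poly_Var) auto
    ultimately show "poly_SM {Ind_b, Ind_d, Ind_lam, Ind_q} (\<lambda>n. row_poly T n (Var Ind_q)) \<and>
       poly_log_convex {Ind_b, Ind_d, Ind_lam, Ind_q} 3 (\<lambda>n. row_poly T n (Var Ind_q)) \<and>
       poly_SM {Ind_b, Ind_d, Ind_lam} (\<lambda>n. T n 0) \<and>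
       poly_log_convex {Ind_b, Ind_d, Ind_lam} 3 (\<lambda>n. T n 0)"
      unfolding row_poly_generalized_lah[OF T] first_column_generalized_lah[OF T] by (simp add: *)
  qed
next
  show "\<forall>(b::real) (f::nat \<Rightarrow> real).
       b > 0 \<and>
       Abs_fps (\<lambda>n. if n = 0 then 0 else f n / fact n) = (lah_root_fps a b - 1) / fps_const b \<longrightarrow>
       stieltjes_moment (\<lambda>n. f (n + 1))"
    using stieltjes_moment_lah_root by blast
next
  show "\<forall>(b::real) d lam T.
       b \<ge> 0 \<and> d \<ge> 0 \<and> lam \<ge> 0 \<and> generalized_lah a b b d lam T \<longrightarrow> preserves_stieltjes T"
    using preserves_stieltjes_generalized_lah by blast
next
  show "\<forall>(b::'k::field_char_0) c lam q T m.
       a + 1 = m \<and> generalized_lah a b c 0 lam T \<longrightarrow>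
       is_branched_S_fraction m (lah_branch_coeff m (c * (q + lam)) b)
         (Abs_fps (\<lambda>n. row_poly T n q)) \<and>
       is_branched_S_fraction m (lah_branch_coeff m (c * lam) b) (Abs_fps (\<lambda>n. T n 0))"
    by (auto simp: row_poly_generalized_lah first_column_generalized_lah lah_branched_S_fraction)
next
  show "\<forall>(b::real) c d lam T n.
       b \<ge> 0 \<and> c \<ge> 0 \<and> d \<ge> 0 \<and> lam \<ge> 0 \<and> generalized_lah a b c d lam T \<longrightarrow>
       PF_seq n (T n)"
    using PF_seq_generalized_lah by blast
qed

end
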